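(* Let $\mathbf a:\mathbb R\to\mathcal H$ define a CMF dictionary in dimension $1$, i.e. $\langle\mathbf a(\theta),\mathbf a(\theta')\rangle=\varphi(|\theta-\theta'|^p)$ for a CMF $\varphi$ with $\varphi(0)=1$, $\lim_{x\to\infty}\varphi(x)=0$ and some $0<p\le1$. Then for every finite set $\mathcal S^\star\subset\mathbb R$ of pairwise distinct parameters, OMP achieves exact $\mathrm{card}(\mathcal S^\star)$-step recovery of $\mathcal S^\star$.
   Context: A function $\varphi:[0,\infty)\to\mathbb R$ is completely monotone (CMF) if it is infinitely differentiable on $(0,\infty)$, right-continuous at $0$, and $(-1)^n\varphi^{(n)}(x)\ge0$ for all $x>0$, $n\ge0$. $\mathcal H$ is a real Hilbert space. OMP with input $\mathbf y\in\mathcal H$: set $\mathbf r=\mathbf y$, $\widehat{\mathcal S}=\emptyset$, $t=0$; while $\mathbf r\ne 0$: $t\leftarrow t+1$; choose any $\widehat\theta_t\in\arg\max_{\theta}|\langle\mathbf a(\theta),\mathbf r\rangle|$; $\widehat{\mathcal S}\leftarrow\widehat{\mathcal S}\cup\{\widehat\theta_t\}$; compute $(\widehat c_1,\dots,\widehat c_t)\in\arg\min_{c\in\mathbb R^t}\|\mathbf y-\sum_{\ell=1}^t c_\ell\mathbf a(\widehat\theta_\ell)\|$; set $\mathbf r=\mathbf y-\sum_{\ell=1}^t\widehat c_\ell\mathbf a(\widehat\theta_\ell)$. Output $\widehat{\mathcal S}$. A reachable support is any output obtainable through some sequence of choices of maximizers. OMP achieves exact $k$-step recovery of $\mathcal S^\star=\{\theta^\star_\ell\}_{\ell=1}^k$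 if for every choice of nonzero reals $c_1,\dots,c_k$, every reachable support of OMP with input $\mathbf y=\sum_{\ell=1}^k c_\ell\mathbf a(\theta^\star_\ell)$ equals $\mathcal S^\star$. *)

theory Defs
  imports "HOL-Analysis.Analysis"
begin

text \<open>Completely monotone function on [0,infinity): infinitely differentiable on (0,infinity),
  right-continuous at 0, and (-1)^n phi^(n)(x) >= 0 for x > 0. Values of phi at negative
  arguments are irrelevant.\<close>
definition cmf :: "(real \<Rightarrow> real) \<Rightarrow> bool" where
  "cmf \<phi> \<longleftrightarrow>
     (\<forall>n. \<forall>x>0. ((deriv ^^ n) \<phi>) differentiable (at x)) \<and>
     (\<phi> \<longlongrightarrow> \<phi> 0) (at_right 0) \<and>
     (\<forall>n. \<forall>x>0. (-1) ^ n * (deriv ^^ n) \<phi> x \<ge> 0)"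

inductive omp_run :: "(real \<Rightarrow> 'h::real_inner) \<Rightarrow> 'h \<Rightarrow> real list \<Rightarrow> 'h \<Rightarrow> bool"
  for a :: "real \<Rightarrow> 'h" and y :: 'h where
  init: "omp_run a y [] y"
| step: "\<lbrakk> omp_run a y sel r; r \<noteq> 0;
           \<forall>\<theta>'. \<bar>inner (a \<theta>') r\<bar> \<le> \<bar>inner (a \<theta>) r\<bar>;
           \<forall>c'::nat \<Rightarrow> real.
              norm (y - (\<Sum>l<length (sel @ [\<theta>]). c l *\<^sub>R a ((sel @ [\<theta>]) ! l)))
              \<le> norm (y - (\<Sum>l<length (sel @ [\<theta>]). c' l *\<^sub>R a ((sel @ [\<theta>]) ! l))) \<rbrakk>
         \<Longrightarrow> omp_run a y (sel @ [\<theta>])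
               (y - (\<Sum>l<length (sel @ [\<theta>]). c l *\<^sub>R a ((sel @ [\<theta>]) ! l)))"

definition reachable_support :: "(real \<Rightarrow> 'h::real_inner) \<Rightarrow> 'h \<Rightarrow> real set \<Rightarrow> bool" where
  "reachable_support a y S \<longleftrightarrow> (\<exists>sel. omp_run a y sel 0 \<and> S = set sel)"

definition exact_recovery :: "(real \<Rightarrow> 'h::real_inner) \<Rightarrow> real set \<Rightarrow> bool" where
  "exact_recovery a Sstar \<longleftrightarrow>
     (\<forall>c::real \<Rightarrow> real. (\<forall>\<theta>\<in>Sstar. c \<theta> \<noteq> 0) \<longrightarrow>
        (\<forall>S. reachable_support a (\<Sum>\<theta>\<in>Sstar. c \<theta> *\<^sub>R a \<theta>) S \<longrightarrow> S = Sstar))"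

end

theory Submission
  imports Defs "HOL-Real_Asymp.Real_Asymp"
begin

text \<open>
  Write $\psi(t) = \varphi(t^p)$, again a completely monotone function. The key is a maximum
  principle: a combination $\sum_i \beta_i \psi(|z - \theta_i|)$ is bounded by the maximum of $0$ and
  its values at those $\theta_i$ with $\beta_i > 0$. By approximation it suffices to treat mixtures
  of geometric kernels $\rho^{|n|}$ on the integers (Hausdorff's moment construction). Each of these
  is, up to a factor, a resolvent $(1 - y A)^{-1}$ of the averaging operator $A$, so a mixture is a
  power series in $A$ with log-convex coefficients; by Kaluza's theorem its reciprocal is
  $c (1 - \sum_k f_k A^k)$ with $f_k \ge 0$ and $\sum_k f_k < 1$, which gives the maximum principle.

  Consequently the atoms are independent, and the projection of an atom $a(x)$ onto the span of
  finitely many others has nonnegative coefficients $g_\eta$ whose sum is less than $1$. Hence the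
  correlation of a nonzero residual in the span of the support, as a function of the parameter,
  attains its maximal modulus only on the support, and the greedy selection never leaves it.
\<close>

subsection \<open>Completely monotone functions and their differences\<close>

text \<open>This is \<open>(-1)^j\<close> times the j-th forward difference, that is
  \<open>(1 - E)^j s\<close> at \<open>k\<close> for the shift \<open>E\<close>. Nonnegativity for
  all \<open>j\<close> and \<open>k\<close> is Hausdorff's complete monotonicity of a
  sequence.\<close>

primrec bdiff :: "nat \<Rightarrow> (nat \<Rightarrow> real) \<Rightarrow> nat \<Rightarrow> real" where
  "bdiff 0 s k = s k"
| "bdiff (Suc j) s k = bdiff j s k - bdiff j s (Suc k)"

lemma bdiff_Suc_inner: "bdiff (Suc j) s k = bdiff j (\<lambda>k. s k - s (Suc k)) k"
  by (induction j arbitrary: k) (simp_all)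

lemma tendsto_bdiff:
  assumes "\<And>k. ((\<lambda>x. s x k) \<longlongrightarrow> t k) F"
  shows "((\<lambda>x. bdiff j (s x) k) \<longlongrightarrow> bdiff j t k) F"
  by (induction j arbitrary: k) (auto intro!: tendsto_intros assms)

text \<open>The witness \<open>f'\<close> is the negated derivative, so that all conditions are signless.\<close>
primrec cm_upto :: "nat \<Rightarrow> (real \<Rightarrow> real) \<Rightarrow> bool" where
  "cm_upto 0 f \<longleftrightarrow> (\<forall>x>0. 0 \<le> f x)"
| "cm_upto (Suc n) f \<longleftrightarrow> (\<forall>x>0. 0 \<le> f x) \<and>
     (\<exists>f'. (\<forall>x>0. (f has_real_derivative - f' x) (at x)) \<and> cm_upto n f')"

lemma cm_upto_nonneg: "cm_upto n f \<Longrightarrow> 0 < x \<Longrightarrow> 0 \<le> f x"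
  by (cases n) auto

lemma cm_upto_add: "cm_upto n f \<Longrightarrow> cm_upto n g \<Longrightarrow> cm_upto n (\<lambda>x. f x + g x)"
proof (induction n arbitrary: f g)
  case (Suc n)
  obtain f' g' where d: "\<forall>x>0. (f has_real_derivative - f' x) (at x)"
    "\<forall>x>0. (g has_real_derivative - g' x) (at x)" and c: "cm_upto n f'" "cm_upto n g'"
    using Suc.prems by auto
  have "\<forall>x>0. ((\<lambda>x. f x + g x) has_real_derivative - (f' x + g' x)) (at x)"
    using d by (auto intro!: derivative_eq_intros)
  with Suc.IH[OF c] Suc.prems show ?case
    by (auto intro!: exI[of _ "\<lambda>x. f' x + g' x"])
qed simp

lemma cm_upto_cmult: "cm_upto n f \<Longrightarrow> 0 \<le> c \<Longrightarrow> cm_upto n (\<lambda>x. c * f x)"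
proof (induction n arbitrary: f)
  case (Suc n)
  obtain f' where d: "\<forall>x>0. (f has_real_derivative - f' x) (at x)" and c: "cm_upto n f'"
    using Suc.prems by auto
  have "\<forall>x>0. ((\<lambda>x. c * f x) has_real_derivative - (c * f' x)) (at x)"
    using d by (auto intro!: derivative_eq_intros)
  with Suc.IH[OF c] Suc.prems show ?case
    by (auto intro!: exI[of _ "\<lambda>x. c * f' x"])
qed simp

lemma cm_upto_antimono:
  assumes "cm_upto (Suc n) f" "0 < x" "x \<le> y"
  shows "f y \<le> f x"
proof -
  obtain f' where d: "\<And>x. 0 < x \<Longrightarrow> (f has_real_derivative - f' x) (at x)" and c: "cm_upto n f'"
    using assms(1) by auto
  show ?thesis
  proof (rule DERIV_nonpos_imp_nonincreasing[OF assms(3)])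
    fix t assume "x \<le> t" "t \<le> y"
    then have "0 < t" using assms by simp
    then show "\<exists>z. (f has_real_derivative z) (at t) \<and> z \<le> 0"
      using d cm_upto_nonneg[OF c] by (intro exI[of _ "- f' t"]) simp
  qed
qed

text \<open>Each difference costs one order: its sign is the monotonicity of \<open>f\<close>, which
  spends one derivative. Differencing commutes with differentiation, so the witness is the same
  difference of \<open>f'\<close>.\<close>

lemma cm_upto_diff:
  "cm_upto (Suc n) f \<Longrightarrow> 0 \<le> h \<Longrightarrow> cm_upto n (\<lambda>x. f x - f (x + h))"
proof (induction n arbitrary: f)
  case 0
  then show ?case using cm_upto_antimono[of 0 f] by simp
next
  case (Suc n)
  obtain f' where d: "\<forall>x>0. (f has_real_derivative - f' x) (at x)" and c: "cm_upto (Suc n) f'"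
    using Suc.prems by (subst (asm) cm_upto.simps(2)) blast
  have "\<forall>x>0. ((\<lambda>x. f x - f (x + h)) has_real_derivative - (f' x - f' (x + h))) (at x)"
  proof (intro allI impI)
    fix x :: real assume "0 < x"
    then have "(f has_real_derivative - f' (x + h)) (at (x + h))"
      using d Suc.prems by auto
    then have "((\<lambda>x. f (x + h)) has_real_derivative - f' (x + h)) (at x)"
      by (simp add: DERIV_shift)
    with d \<open>0 < x\<close> show "((\<lambda>x. f x - f (x + h)) has_real_derivative - (f' x - f' (x + h))) (at x)"
      by (auto intro!: derivative_eq_intros)
  qed
  moreover have "\<forall>x>0. 0 \<le> f x - f (x + h)"
    using cm_upto_antimono[OF Suc.prems(1)] Suc.prems(2) by simp
  ultimately show ?case
    using Suc.IH[OF c Suc.prems(2)]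
    unfolding cm_upto.simps(2) by (intro conjI exI[of _ "\<lambda>x. f' x - f' (x + h)"])
qed

lemma cm_upto_bdiff:
  "cm_upto j f \<Longrightarrow> 0 < x \<Longrightarrow> 0 \<le> h \<Longrightarrow> 0 \<le> bdiff j (\<lambda>k. f (x + real k * h)) k"
proof (induction j arbitrary: f)
  case 0
  then show ?case by (simp add: add_pos_nonneg)
next
  case (Suc j)
  have "0 \<le> bdiff j (\<lambda>k. f (x + real k * h) - f (x + real k * h + h)) k"
    by (rule Suc.IH[OF cm_upto_diff]) (use Suc.prems in auto)
  then show ?case
    unfolding bdiff_Suc_inner by (simp add: algebra_simps)
qed

text \<open>Differentiating \<open>\<phi> (t powr p)\<close> repeatedly produces factors
  \<open>t powr (- b)\<close>, so the induction runs over all \<open>k\<close> and \<open>b\<close>.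
  Minus the derivative of such a function combines two others with the nonnegative coefficients
  \<open>p\<close> and \<open>b\<close>; \<open>p \<le> 1\<close> keeps the exponent
  \<open>1 - p + b\<close> nonnegative.\<close>

lemma cmf_cm_upto_powr:
  assumes "cmf \<phi>" "0 < p" "p \<le> 1"
  shows "0 \<le> b \<Longrightarrow> cm_upto n (\<lambda>t. (-1) ^ k * (deriv ^^ k) \<phi> (t powr p) * t powr (- b))"
proof (induction n arbitrary: k b)
  case 0
  then show ?case using assms(1) by (simp add: cmf_def)
next
  case (Suc n)
  let ?g = "\<lambda>k b t. (-1) ^ k * (deriv ^^ k) \<phi> (t powr p) * t powr (- b)"
  let ?g' = "\<lambda>t. p * ?g (Suc k) (1 - p + b) t + b * ?g k (b + 1) t"
  have "\<forall>x>0. (?g k b has_real_derivative - ?g' x) (at x)"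
  proof (intro allI impI)
    fix x :: real assume x: "0 < x"
    have "((deriv ^^ k) \<phi>) differentiable (at (x powr p))"
      using assms(1) x by (simp add: cmf_def)
    then have "((deriv ^^ k) \<phi> has_real_derivative (deriv ^^ Suc k) \<phi> (x powr p)) (at (x powr p))"
      by (simp add: DERIV_deriv_iff_real_differentiable)
    then have "((\<lambda>t. (deriv ^^ k) \<phi> (t powr p)) has_real_derivative
        (deriv ^^ Suc k) \<phi> (x powr p) * (p * x powr (p - 1))) (at x)"
      by (rule DERIV_chain2) (use x in \<open>auto intro!: derivative_eq_intros simp: powr_diff\<close>)
    then have "(?g k b has_real_derivative
        ((-1) ^ k * ((deriv ^^ Suc k) \<phi> (x powr p) * (p * x powr (p - 1)))) * x powr (- b)
        + (- b * x powr (- b - 1)) * ((-1) ^ k * (deriv ^^ k) \<phi> (x powr p))) (at x)"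
      by (intro DERIV_mult DERIV_cmult)
        (use x in \<open>auto intro!: derivative_eq_intros simp: powr_diff\<close>)
    moreover have "x powr - (1 - p + b) = x powr (p - 1) * x powr (- b)"
      by (simp flip: powr_add)
    moreover have "x powr - (b + 1) = x powr (- b - 1)"
      by simp
    ultimately show "(?g k b has_real_derivative - ?g' x) (at x)"
      by (elim DERIV_cong) (simp only:, simp add: algebra_simps)
  qed
  moreover have "cm_upto n ?g'"
    by (intro cm_upto_add cm_upto_cmult Suc.IH) (use Suc.prems assms in auto)
  moreover have "\<forall>x>0. 0 \<le> ?g k b x"
    using assms(1) by (simp add: cmf_def)
  ultimately show ?case
    unfolding cm_upto.simps(2) by (intro conjI exI[of _ ?g'])
qed

lemma cm_upto_cong:
  assumes "cm_upto n f" "\<And>x. 0 < x \<Longrightarrow> f x = g x"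
  shows "cm_upto n g"
proof (cases n)
  case 0
  then show ?thesis using assms by simp
next
  case (Suc l)
  then obtain f' where f': "\<forall>x>0. (f has_real_derivative - f' x) (at x)" "cm_upto l f'"
    using assms(1) by auto
  have "(g has_real_derivative - f' x) (at x)" if "0 < x" for x
    by (rule has_field_derivative_transform_within_open[of f _ _ "{0<..}"])
      (use f' assms(2) that in auto)
  then show ?thesis using f' assms Suc by auto
qed

lemma cm_continuous_on:
  assumes cm: "\<And>n. cm_upto n \<psi>" and zero: "(\<psi> \<longlongrightarrow> \<psi> 0) (at_right 0)"
  shows "continuous_on {0..} \<psi>"
  unfolding continuous_on_def
proof
  fix x :: real assume x: "x \<in> {0..}"
  show "(\<psi> \<longlongrightarrow> \<psi> x) (at x within {0..})"
  proof (cases "x = 0")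
    case True
    then show ?thesis using zero by (simp add: at_within_Ici_at_right)
  next
    case False
    obtain f' where "\<forall>x>0. (\<psi> has_real_derivative - f' x) (at x)"
      using cm[of "Suc 0"] by auto
    then have "(\<psi> has_real_derivative - f' x) (at x)" using x False by simp
    then have "isCont \<psi> x" by (rule DERIV_isCont)
    then show ?thesis unfolding isCont_def by (rule tendsto_within_subset) simp
  qed
qed

text \<open>Derivatives control \<open>\<psi>\<close> only on the open half-line; the base point 0
  is reached as the limit of \<open>x + d\<close> for \<open>d\<close> decreasing to 0.\<close>

lemma cm_bdiff_nonneg:
  assumes cm: "\<And>n. cm_upto n \<psi>" and zero: "(\<psi> \<longlongrightarrow> \<psi> 0) (at_right 0)" and "0 \<le> x" "0 \<le> h"
  shows "0 \<le> bdiff j (\<lambda>k. \<psi> (x + real k * h)) k"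
proof (rule tendsto_lowerbound)
  show "((\<lambda>d. bdiff j (\<lambda>k. \<psi> (x + d + real k * h)) k)
      \<longlongrightarrow> bdiff j (\<lambda>k. \<psi> (x + real k * h)) k) (at_right 0)"
  proof (intro tendsto_bdiff continuous_on_tendsto_compose[OF cm_continuous_on[OF cm zero]])
    show "((\<lambda>d. x + d + real k * h) \<longlongrightarrow> x + real k * h) (at_right 0)" for k
      by (auto intro!: tendsto_eq_intros)
    show "\<forall>\<^sub>F d in at_right 0. x + d + real k * h \<in> {0..}" for k
      using eventually_at_right_less[of "0 :: real"] by eventually_elim (use assms in simp)
  qed (use assms in simp)
  show "\<forall>\<^sub>F d in at_right 0. 0 \<le> bdiff j (\<lambda>k. \<psi> (x + d + real k * h)) k"
    using eventually_at_right_less[of "0 :: real"]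
    by eventually_elim (use assms in \<open>auto intro!: cm_upto_bdiff\<close>)
qed simp

subsection \<open>Hausdorff's approximation of completely monotone sequences\<close>

text \<open>With the shift \<open>E\<close> this is the binomial expansion of
  \<open>((1 - E) + E)^M = 1\<close>, applied to \<open>s\<close> at \<open>n\<close>. For
  \<open>n = 0\<close> it gives the total mass of the Hausdorff weights.\<close>

lemma hausdorff_sum: "(\<Sum>k\<le>M. real (M choose k) * bdiff (M - k) s (n + k)) = s n"
proof (induction M arbitrary: n)
  case (Suc M)
  have "(\<Sum>k\<le>Suc M. real (Suc M choose k) * bdiff (Suc M - k) s (n + k))
      = bdiff (Suc M) s n + (\<Sum>k\<le>M. real (Suc M choose Suc k) * bdiff (M - k) s (n + Suc k))"
    by (subst sum.atMost_Suc_shift) simp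
  also have "\<dots> = bdiff (Suc M) s n + (\<Sum>k\<le>M. real (M choose Suc k) * bdiff (M - k) s (n + Suc k))
      + (\<Sum>k\<le>M. real (M choose k) * bdiff (M - k) s (Suc n + k))"
    by (simp add: ring_distribs sum.distrib)
  also have "bdiff (Suc M) s n + (\<Sum>k\<le>M. real (M choose Suc k) * bdiff (M - k) s (n + Suc k))
      = (\<Sum>k\<le>Suc M. real (M choose k) * bdiff (Suc M - k) s (n + k))"
    by (subst sum.atMost_Suc_shift) simp
  also have "\<dots> = (\<Sum>k\<le>M. real (M choose k) * bdiff (M - k) s (n + k))
      - (\<Sum>k\<le>M. real (M choose k) * bdiff (M - k) s (Suc n + k))"
    by (simp add: Suc_diff_le ring_distribs sum_subtractf)
  finally show ?case using Suc.IH by simp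
qed simp

text \<open>The product is \<open>(k choose n) / (N choose n)\<close>, a discrete substitute for
  \<open>(k / N)^n\<close>. Absorbing it into \<open>N choose k\<close> leaves the binomial
  expansion of order \<open>N - n\<close> at \<open>n\<close>, so these factorial moments are
  exact.\<close>

lemma hausdorff_moment:
  assumes "n \<le> N"
  shows "(\<Sum>k\<le>N. real (N choose k) * bdiff (N - k) s k * (\<Prod>i<n. (real k - real i) / (real N - real i))) = s n"
proof -
  have q: "(\<Prod>i<n. (real k - real i) / (real N - real i)) = real (k choose n) / real (N choose n)" for k
    by (simp add: binomial_gbinomial gbinomial_prod_rev prod_dividef atLeast0LessThan)
  have "(\<Sum>k\<le>N. real (N choose k) * bdiff (N - k) s k * (real (k choose n) / real (N choose n)))
     = (\<Sum>k\<in>{n..N}. real (N choose k) * bdiff (N - k) s k * (real (k choose n) / real (N choose n)))"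
    by (rule sum.mono_neutral_right) auto
  also have "\<dots> = (\<Sum>k\<in>{n..N}. real ((N - n) choose (k - n)) * bdiff (N - k) s k)"
  proof (rule sum.cong[OF refl])
    fix k assume k: "k \<in> {n..N}"
    then have "real (N choose k) * real (k choose n) = real (N choose n) * real ((N - n) choose (k - n))"
      using choose_mult[of n k N] by (metis atLeastAtMost_iff of_nat_mult)
    moreover have "real (N choose n) \<noteq> 0" using assms by simp
    ultimately show "real (N choose k) * bdiff (N - k) s k * (real (k choose n) / real (N choose n))
      = real ((N - n) choose (k - n)) * bdiff (N - k) s k"
      by (simp add: field_simps)
  qed
  also have "\<dots> = (\<Sum>k\<le>N - n. real ((N - n) choose k) * bdiff (N - n - k) s (n + k))"
    by (rule sum.reindex_bij_witness[of _ "\<lambda>k. n + k" "\<lambda>k. k - n"]) (use assms in auto)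
  also have "\<dots> = s n" by (rule hausdorff_sum)
  finally show ?thesis unfolding q .
qed

text \<open>Replacing the exact factorial moments by powers costs an error of order
  \<open>1 / N\<close>, uniformly in \<open>k\<close>, against the total mass \<open>s 0\<close>.
  The nodes are \<open>(k + 1) / (N + 2)\<close> instead of \<open>k / N\<close> because the
  geometric kernels need ratios strictly between 0 and 1.\<close>

lemma hausdorff_approx:
  assumes "\<And>j k. 0 \<le> bdiff j s k"
  shows "(\<lambda>N. \<Sum>k\<le>N. real (N choose k) * bdiff (N - k) s k * ((real k + 1) / (real N + 2)) ^ n)
    \<longlonglongrightarrow> s n"
proof -
  let ?w = "\<lambda>N k. real (N choose k) * bdiff (N - k) s k"
  let ?a = "\<lambda>N. \<Sum>k\<le>N. ?w N k * ((real k + 1) / (real N + 2)) ^ n"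
  have bound: "\<bar>?a N - s n\<bar> \<le> s 0 * (real n * ((real n + 2) / (real N - real n)))" if N: "2 * n < N" for N
  proof -
    have diff: "\<bar>((real k + 1) / (real N + 2)) ^ n - (\<Prod>i<n. (real k - real i) / (real N - real i))\<bar>
        \<le> real n * ((real n + 2) / (real N - real n))" if k: "k \<le> N" for k
    proof -
      have "\<bar>(\<Prod>i<n. (real k + 1) / (real N + 2)) - (\<Prod>i<n. (real k - real i) / (real N - real i))\<bar>
         \<le> (\<Sum>i<n. \<bar>(real k + 1) / (real N + 2) - (real k - real i) / (real N - real i)\<bar>)"
        unfolding real_norm_def[symmetric]
      proof (rule norm_prod_diff)
        fix i assume "i \<in> {..<n}"
        then have i: "i < n" by simp
        show "norm ((real k + 1) / (real N + 2)) \<le> 1" using k by simp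
        \<comment> \<open>For \<open>k < i\<close> the numerator is negative with modulus at most
          \<open>i\<close>; here \<open>2 * n < N\<close> ensures
          \<open>i \<le> N - i\<close>.\<close>
        show "norm ((real k - real i) / (real N - real i)) \<le> 1"
          using k i N by (simp add: abs_le_iff divide_le_eq)
      qed
      also have "\<dots> \<le> (\<Sum>i<n. (real n + 2) / (real N - real n))"
      proof (rule sum_mono)
        fix i assume "i \<in> {..<n}"
        then have i: "i < n" by simp
        have pos: "0 < real N - real i" "0 < real N - real n" using i N by auto
        have "(real k + 1) / (real N + 2) - (real k - real i) / (real N - real i)
            = ((real N - real k) * (real i + 1) + real i - real k) / ((real N + 2) * (real N - real i))"
          using pos by (simp add: divide_simps) (simp add: algebra_simps)
        moreover have "\<bar>(real N - real k) * (real i + 1) + real i - real k\<bar> \<le> (real n + 2) * (real N + 2)"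
        proof -
          have "(real N - real k) * (real i + 1) \<le> (real N + 2) * (real n + 1)"
            using k i by (intro mult_mono) auto
          moreover have "0 \<le> (real N - real k) * (real i + 1)" using k by simp
          moreover have "\<bar>real i - real k\<bar> \<le> real N + 2" using k i N by auto
          ultimately show ?thesis by (simp add: algebra_simps abs_le_iff)
        qed
        moreover have "\<bar>u / ((real N + 2) * (real N - real i))\<bar>
            = \<bar>u\<bar> / ((real N + 2) * (real N - real i))" for u
          using pos by (simp add: abs_mult)
        moreover have "0 \<le> (real N + 2) * (real N - real i)"
          using pos by simp
        ultimately have "\<bar>(real k + 1) / (real N + 2) - (real k - real i) / (real N - real i)\<bar>
            \<le> ((real n + 2) * (real N + 2)) / ((real N + 2) * (real N - real i))"
          by (simp only: divide_right_mono)
        also have "\<dots> = (real n + 2) / (real N - real i)" by simp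
        also have "\<dots> \<le> (real n + 2) / (real N - real n)"
          using pos i by (intro divide_left_mono) auto
        finally show "\<bar>(real k + 1) / (real N + 2) - (real k - real i) / (real N - real i)\<bar>
            \<le> (real n + 2) / (real N - real n)" .
      qed
      finally show ?thesis by simp
    qed
    have "?a N - s n = (\<Sum>k\<le>N. ?w N k * (((real k + 1) / (real N + 2)) ^ n
        - (\<Prod>i<n. (real k - real i) / (real N - real i))))"
      using hausdorff_moment[of n N s] N by (simp add: right_diff_distrib sum_subtractf)
    then have "\<bar>?a N - s n\<bar> = \<bar>\<Sum>k\<le>N. ?w N k * (((real k + 1) / (real N + 2)) ^ n
        - (\<Prod>i<n. (real k - real i) / (real N - real i)))\<bar>"
      by (rule arg_cong)
    also have "\<dots> \<le> (\<Sum>k\<le>N. ?w N k * (real n * ((real n + 2) / (real N - real n))))"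
    proof (rule order_trans[OF sum_abs], rule sum_mono)
      fix k assume "k \<in> {..N}"
      then have "?w N k * \<bar>((real k + 1) / (real N + 2)) ^ n
          - (\<Prod>i<n. (real k - real i) / (real N - real i))\<bar>
        \<le> ?w N k * (real n * ((real n + 2) / (real N - real n)))"
        using assms by (intro mult_left_mono[OF diff] mult_nonneg_nonneg) simp_all
      moreover have "\<bar>?w N k * u\<bar> = ?w N k * \<bar>u\<bar>" for u
        using assms by (simp add: abs_mult)
      ultimately show "\<bar>?w N k * (((real k + 1) / (real N + 2)) ^ n
          - (\<Prod>i<n. (real k - real i) / (real N - real i)))\<bar>
        \<le> ?w N k * (real n * ((real n + 2) / (real N - real n)))"
        by (simp only:)
    qed
    also have "\<dots> = (\<Sum>k\<le>N. ?w N k) * (real n * ((real n + 2) / (real N - real n)))"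
      by (simp only: sum_distrib_right)
    also have "(\<Sum>k\<le>N. ?w N k) = s 0"
      using hausdorff_sum[of N s 0] by simp
    finally show ?thesis .
  qed
  have "(\<lambda>N. s 0 * (real n * ((real n + 2) / (real N - real n)))) \<longlonglongrightarrow> 0"
    by real_asymp
  then have "(\<lambda>N. ?a N - s n) \<longlonglongrightarrow> 0"
    by (rule Lim_null_comparison[rotated])
      (use bound in \<open>auto intro!: eventually_sequentiallyI[of "2 * n + 1"]\<close>)
  then show ?thesis by (simp add: LIM_zero_iff)
qed

subsection \<open>The maximum principle\<close>

text \<open>The generating function of \<open>f\<close> is \<open>1 - m 0 / M\<close>. Log-convexity
  makes the ratios of consecutive terms increase; nonnegativity follows by comparing the renewal
  identity for \<open>m (Suc l)\<close> with the one for \<open>m l\<close> multiplied by the last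
  ratio.\<close>

lemma kaluza:
  fixes m :: "nat \<Rightarrow> real"
  assumes pos: "\<And>n. 0 < m n" and conv: "\<And>n. (m (Suc n))\<^sup>2 \<le> m n * m (Suc (Suc n))"
  shows "\<exists>f. f 0 = 0 \<and> (\<forall>n. 0 \<le> f n) \<and> (\<forall>n. m (Suc n) = (\<Sum>k\<le>Suc n. f k * m (Suc n - k)))"
proof -
  define M where "M = Abs_fps m"
  define F where "F = 1 - inverse M * fps_const (m 0)"
  define f where "f = fps_nth F"
  have "fps_nth M 0 \<noteq> 0" using pos[of 0] by (simp add: M_def)
  then have "inverse M * M = 1" by (rule inverse_mult_eq_1)
  then have FM: "F * M = M - fps_const (m 0)"
    by (simp add: F_def algebra_simps flip: mult.assoc)
  have conv_eq: "(\<Sum>k\<le>n. f k * m (n - k)) = m n - (if n = 0 then m 0 else 0)" for n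
    using arg_cong[OF FM, of "\<lambda>X. fps_nth X n"]
    by (simp add: fps_mult_nth f_def M_def atLeast0AtMost)
  have f0: "f 0 = 0" using conv_eq[of 0] pos[of 0] by simp
  have ren: "m (Suc n) = (\<Sum>k\<le>Suc n. f k * m (Suc n - k))" for n
    using conv_eq[of "Suc n"] by simp
  have ratio: "incseq (\<lambda>n. m (Suc n) / m n)"
    by (rule incseq_SucI) (use pos conv in \<open>simp add: field_simps power2_eq_square\<close>)
  have "0 \<le> f n" for n
  proof (induction n rule: less_induct)
    case (less n)
    show ?case
    proof (cases n)
      case 0
      then show ?thesis using f0 by simp
    next
      case (Suc l)
      \<comment> \<open>The comparison uses the renewal identity at \<open>l\<close>, which is
        available only for positive \<open>l\<close>; hence \<open>f 1\<close> is computed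
        directly.\<close>
      show ?thesis
      proof (cases l)
        case 0
        then have "m 1 = f 1 * m 0" using ren[of 0] f0 by simp
        then show ?thesis using pos[of 0] pos[of 1] 0 Suc
          by (metis One_nat_def less_eq_real_def zero_less_mult_pos2)
      next
        case (Suc l')
        define r where "r = m (Suc l) / m l"
        have "m (Suc l) = m l * r" using pos[of l] by (simp add: r_def)
        also have "m l = (\<Sum>k\<le>l. f k * m (l - k))" using ren[of l'] Suc by simp
        finally have 1: "m (Suc l) = (\<Sum>k\<le>l. f k * (m (l - k) * r))"
          by (simp add: sum_distrib_right mult.assoc)
        have 2: "m (Suc l) = (\<Sum>k\<le>l. f k * m (Suc l - k)) + f (Suc l) * m 0"
          using ren[of l] by simp
        have "(\<Sum>k\<le>l. f k * m (Suc l - k)) \<le> (\<Sum>k\<le>l. f k * (m (l - k) * r))"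
        proof (intro sum_mono mult_left_mono)
          fix k assume k: "k \<in> {..l}"
          have "m (Suc (l - k)) / m (l - k) \<le> r"
            unfolding r_def by (rule incseqD[OF ratio]) simp
          then show "m (Suc l - k) \<le> m (l - k) * r"
            using k pos[of "l - k"] by (simp add: divide_le_eq Suc_diff_le mult.commute)
          show "0 \<le> f k" using less \<open>n = Suc l\<close> k by simp
        qed
        then have "0 \<le> f (Suc l) * m 0" using 1 2 by linarith
        then show ?thesis using pos[of 0] \<open>n = Suc l\<close> by (simp add: zero_le_mult_iff)
      qed
    qed
  qed
  with f0 have "f 0 = 0 \<and> (\<forall>n. 0 \<le> f n)" by simp
  then show ?thesis using ren by (intro exI[of _ f]) iprover
qed

text \<open>Let \<open>A\<close> average the two neighbours. Formally the recursion makes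
  \<open>F 0\<close> the sum of the \<open>m k A^k b\<close>, and the renewal identity turns this
  into \<open>m 0 b\<close> plus the sum of the \<open>f k A^k (F 0)\<close>. Truncating at
  \<open>N\<close> and inserting the bound \<open>P\<close> leaves a remainder of size
  \<open>m (Suc N)\<close>.\<close>

lemma renewal_bound:
  fixes F :: "nat \<Rightarrow> int \<Rightarrow> real"
  assumes step: "\<And>n z. F n z = m n * b z + (F (Suc n) (z - 1) + F (Suc n) (z + 1)) / 2"
    and bound: "\<And>n z. \<bar>F n z\<bar> \<le> E * m n"
    and m: "\<And>n. 0 \<le> m n"
    and f: "f 0 = 0" "\<And>n. 0 \<le> f n"
    and ren: "\<And>n. m (Suc n) = (\<Sum>k\<le>Suc n. f k * m (Suc n - k))"
    and le: "\<And>z. F 0 z \<le> P"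
  shows "F 0 z \<le> m 0 * b z + (\<Sum>k\<le>N. f k) * P + 2 * E * m (Suc N)"
proof -
  \<comment> \<open>The renewal identity eliminates \<open>b\<close> from the recursion of this combination.\<close>
  define G where "G = (\<lambda>n z. F n z - (\<Sum>k<n. f k * F (n - k) z))"
  have G_step: "G (Suc n) z = f (Suc n) * F 0 z + (G (Suc (Suc n)) (z - 1) + G (Suc (Suc n)) (z + 1)) / 2"
    for n z
  proof -
    have av: "(F (Suc i) (z - 1) + F (Suc i) (z + 1)) / 2 = F i z - m i * b z" for i
      using step[of i z] by simp
    have "(G (Suc (Suc n)) (z - 1) + G (Suc (Suc n)) (z + 1)) / 2
      = (F (Suc (Suc n)) (z - 1) + F (Suc (Suc n)) (z + 1)) / 2
        - (\<Sum>k\<le>Suc n. f k * ((F (Suc (Suc n - k)) (z - 1) + F (Suc (Suc n - k)) (z + 1)) / 2))"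
      by (simp add: G_def lessThan_Suc_atMost Suc_diff_le sum.distrib sum_subtractf
          ring_distribs add_divide_distrib diff_divide_distrib sum_divide_distrib)
    also have "\<dots> = (F (Suc n) z - m (Suc n) * b z)
        - (\<Sum>k\<le>Suc n. f k * (F (Suc n - k) z - m (Suc n - k) * b z))"
      unfolding av ..
    also have "\<dots> = F (Suc n) z - (\<Sum>k\<le>Suc n. f k * F (Suc n - k) z)
        - (m (Suc n) - (\<Sum>k\<le>Suc n. f k * m (Suc n - k))) * b z"
      by (simp only: right_diff_distrib left_diff_distrib sum_subtractf sum_distrib_right mult.assoc)
    also have "\<dots> = G (Suc n) z - f (Suc n) * F 0 z"
      using ren[of n] by (simp add: G_def lessThan_Suc_atMost)
    finally show ?thesis by (simp add: field_simps)
  qed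
  have unroll: "G (Suc 0) z \<le> (\<Sum>k\<le>n. f k) * P + D" if "\<And>z. G (Suc n) z \<le> D" for n D z
    using that
  proof (induction n arbitrary: D z)
    case 0
    then show ?case by (simp add: f)
  next
    case (Suc n)
    have "G (Suc n) z \<le> f (Suc n) * P + D" for z
      unfolding G_step[of n]
      using mult_left_mono[OF le[of z] f(2)[of "Suc n"]] Suc.prems[of "z - 1"] Suc.prems[of "z + 1"]
      by (simp add: field_simps)
    from Suc.IH[OF this] show ?case by (simp add: algebra_simps)
  qed
  have "E * m n \<ge> 0" for n using bound[of n 0] by linarith
  \<comment> \<open>One \<open>E * m (Suc N)\<close> bounds \<open>F (Suc N)\<close>; by the renewal
    identity the other bounds the convolution.\<close>
  have G_le: "G (Suc N) z \<le> 2 * E * m (Suc N)" for z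
  proof -
    have "- (f k * F i z) \<le> f k * (E * m i)" for k i
      using mult_left_mono[OF _ f(2), of "- F i z" "E * m i" k] bound[of i z] by simp
    then have "- (\<Sum>k<Suc N. f k * F (Suc N - k) z) \<le> (\<Sum>k<Suc N. f k * (E * m (Suc N - k)))"
      unfolding sum_negf[symmetric] by (intro sum_mono)
    also have "\<dots> \<le> (\<Sum>k\<le>Suc N. f k * (E * m (Suc N - k)))"
      using f \<open>\<And>n. E * m n \<ge> 0\<close> by (simp add: lessThan_Suc_atMost del: sum.lessThan_Suc)
    also have "\<dots> = E * (\<Sum>k\<le>Suc N. f k * m (Suc N - k))"
      by (simp only: sum_distrib_left mult.left_commute)
    also have "\<dots> = E * m (Suc N)"
      unfolding ren[of N, symmetric] ..
    finally show ?thesis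
      using bound[of "Suc N" z] by (simp add: G_def del: sum.lessThan_Suc)
  qed
  \<comment> \<open>\<open>G (Suc 0)\<close> equals \<open>F (Suc 0)\<close> because
    \<open>f 0 = 0\<close>.\<close>
  have "F 0 z = m 0 * b z + (G (Suc 0) (z - 1) + G (Suc 0) (z + 1)) / 2"
    using step[of 0 z] by (simp add: G_def f)
  then show ?thesis
    using unroll[OF G_le, of "z - 1"] unroll[OF G_le, of "z + 1"] by (simp add: field_simps)
qed

section \<open>Mixtures of geometric kernels on the integers\<close>

text \<open>With \<open>y = 2 r / (1 + r^2)\<close>, both \<open>r^n\<close> and
  \<open>r^(-n)\<close> are fixed by \<open>y\<close> times the averaging, since
  \<open>y (r + 1 / r) / 2 = 1\<close>. Only the kink at 0 leaves a defect, of size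
  \<open>1 - y r\<close>.\<close>

lemma geometric_resolvent:
  fixes r :: real and n :: int
  assumes "0 < r"
  shows "r ^ nat \<bar>n\<bar> = (1 - r\<^sup>2) / (1 + r\<^sup>2) * (if n = 0 then 1 else 0)
    + 2 * r / (1 + r\<^sup>2) * ((r ^ nat \<bar>n - 1\<bar> + r ^ nat \<bar>n + 1\<bar>) / 2)"
proof -
  have pos: "1 + r\<^sup>2 \<noteq> 0" using zero_le_power2[of r] by linarith
  have *: "r ^ Suc k = 2 * r / (1 + r\<^sup>2) * ((r ^ k + r ^ Suc (Suc k)) / 2)" for k
    using pos by (simp add: divide_simps) (simp add: algebra_simps power2_eq_square)
  consider "n = 0" | k where "n = int (Suc k)" | k where "n = - int (Suc k)"
    by (metis int_cases3 gr0_implies_Suc)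
  then show ?thesis
  proof cases
    case 1
    then show ?thesis using pos by (simp add: divide_simps) (simp add: power2_eq_square)
  next
    case (2 k)
    then have "nat \<bar>n\<bar> = Suc k" "nat \<bar>n - 1\<bar> = k" "nat \<bar>n + 1\<bar> = Suc (Suc k)" "n \<noteq> 0" by auto
    then show ?thesis using *[of k] by simp
  next
    case (3 k)
    then have "nat \<bar>n\<bar> = Suc k" "nat \<bar>n - 1\<bar> = Suc (Suc k)" "nat \<bar>n + 1\<bar> = k" "n \<noteq> 0" by auto
    then show ?thesis using *[of k] by (simp add: add.commute)
  qed
qed

text \<open>The renewal estimate bounds \<open>f\<close> by \<open>m 0 * b\<close> plus
  \<open>q\<close> times any nonnegative upper bound \<open>P\<close> of \<open>f\<close>, with
  \<open>q < 1\<close>. Where \<open>f\<close> exceeds \<open>C\<close>, \<open>b\<close> is at most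
  0, so \<open>P\<close> improves to \<open>max C (q * P)\<close>; iterating this leaves
  \<open>C\<close>.\<close>

lemma geometric_mixture_max:
  fixes w \<rho> :: "'j \<Rightarrow> real" and t :: "'i \<Rightarrow> int" and \<beta> :: "'i \<Rightarrow> real"
  assumes J: "finite J" "\<And>j. j \<in> J \<Longrightarrow> 0 \<le> w j" "\<exists>j\<in>J. 0 < w j"
    and \<rho>: "\<And>j. j \<in> J \<Longrightarrow> 0 < \<rho> j" "\<And>j. j \<in> J \<Longrightarrow> \<rho> j < 1"
    and I: "finite I"
  defines "f \<equiv> \<lambda>z. \<Sum>i\<in>I. \<beta> i * (\<Sum>j\<in>J. w j * \<rho> j ^ nat \<bar>z - t i\<bar>)"
  assumes C: "0 \<le> C" "\<And>i. i \<in> I \<Longrightarrow> 0 < \<beta> i \<Longrightarrow> f (t i) \<le> C"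
  shows "f z \<le> C"
proof -
  define \<kappa> where "\<kappa> = (\<lambda>j. (1 - (\<rho> j)\<^sup>2) / (1 + (\<rho> j)\<^sup>2))"
  define y where "y = (\<lambda>j. 2 * \<rho> j / (1 + (\<rho> j)\<^sup>2))"
  define m where "m = (\<lambda>n. \<Sum>j\<in>J. w j * \<kappa> j * y j ^ n)"
  have den: "0 < 1 + (\<rho> j)\<^sup>2" for j using zero_le_power2[of "\<rho> j"] by linarith
  have \<kappa>: "0 < \<kappa> j" if "j \<in> J" for j
    using \<rho>[OF that] den[of j] by (simp add: \<kappa>_def abs_square_less_1)
  have y: "0 < y j" "y j < 1" if "j \<in> J" for j
  proof -
    have "0 < (1 - \<rho> j)\<^sup>2" using \<rho>[OF that] by simp
    then show "y j < 1" using den[of j] by (simp add: y_def divide_less_eq power2_eq_square algebra_simps)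
    show "0 < y j" using den[of j] \<rho>[OF that] by (simp add: y_def)
  qed
  have m_pos: "0 < m n" for n
  proof -
    obtain j where j: "j \<in> J" "0 < w j" using J by auto
    show ?thesis unfolding m_def
      by (rule sum_pos2[OF J(1) j(1)]) (use j J \<kappa> y in \<open>auto intro!: mult_nonneg_nonneg simp: less_imp_le\<close>)
  qed
  have m_conv: "(m (Suc n))\<^sup>2 \<le> m n * m (Suc (Suc n))" for n
  proof -
    have nn: "0 \<le> w j * \<kappa> j * y j ^ n" if "j \<in> J" for j
      using J(2) \<kappa> y that by (simp add: less_imp_le)
    \<comment> \<open>Moments of a positive measure are log-convex: Cauchy-Schwarz for
      \<open>?a j\<close> and \<open>?a j * y j\<close> involves exactly the moments of orders n, n
      + 1 and n + 2.\<close>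
    let ?a = "\<lambda>j. sqrt (w j * \<kappa> j * y j ^ n)"
    have "(\<Sum>j\<in>J. ?a j * (?a j * y j))\<^sup>2 \<le> (\<Sum>j\<in>J. (?a j)\<^sup>2) * (\<Sum>j\<in>J. (?a j * y j)\<^sup>2)"
      by (rule Cauchy_Schwarz_ineq_sum)
    also have "(\<Sum>j\<in>J. ?a j * (?a j * y j)) = m (Suc n)"
      unfolding m_def by (rule sum.cong) (use nn in \<open>simp_all flip: mult.assoc\<close>)
    also have "(\<Sum>j\<in>J. (?a j)\<^sup>2) = m n"
      unfolding m_def by (rule sum.cong) (use nn in simp_all)
    also have "(\<Sum>j\<in>J. (?a j * y j)\<^sup>2) = m (Suc (Suc n))"
      unfolding m_def by (rule sum.cong) (use nn in \<open>simp_all add: power_mult_distrib power2_eq_square\<close>)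
    finally show ?thesis .
  qed
  have m_lim: "(\<lambda>N. c * m (Suc N)) \<longlonglongrightarrow> 0" for c
  proof -
    have "(\<lambda>N. y j ^ Suc N) \<longlonglongrightarrow> 0" if "j \<in> J" for j
      using LIMSEQ_Suc[OF LIMSEQ_realpow_zero] y[OF that] less_imp_le by blast
    then have "(\<lambda>N. c * m (Suc N)) \<longlonglongrightarrow> c * (\<Sum>j\<in>J. w j * \<kappa> j * 0)"
      unfolding m_def by (intro tendsto_intros)
    then show ?thesis by simp
  qed
  obtain g where g: "g 0 = 0 \<and> (\<forall>n. 0 \<le> g n) \<and> (\<forall>n. m (Suc n) = (\<Sum>k\<le>Suc n. g k * m (Suc n - k)))"
    using kaluza[of m, OF m_pos m_conv] by (rule exE)
  note g0 = conjunct1[OF g] and g_nonneg = conjunct1[OF conjunct2[OF g], rule_format]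
    and g_renewal = conjunct2[OF conjunct2[OF g], rule_format]
  have key: "\<exists>E. \<forall>N z. (\<Sum>j\<in>J. w j * e j z) \<le> m 0 * b z + (\<Sum>k\<le>N. g k) * P + 2 * E * m (Suc N)"
    if step: "\<And>j z. j \<in> J \<Longrightarrow> e j z = \<kappa> j * b z + y j * ((e j (z - 1) + e j (z + 1)) / 2)"
      and bnd: "\<And>j z. j \<in> J \<Longrightarrow> \<bar>e j z\<bar> \<le> B j" and P: "\<And>z. (\<Sum>j\<in>J. w j * e j z) \<le> P"
    for e :: "'j \<Rightarrow> int \<Rightarrow> real" and b P B
  proof -
    define F where "F = (\<lambda>n z. \<Sum>j\<in>J. w j * y j ^ n * e j z)"
    \<comment> \<open>\<open>E\<close> dominates every \<open>B j / \<kappa> j\<close>, so summing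
      against the weights yields the bound \<open>E * m n\<close>.\<close>
    define E where "E = (\<Sum>j\<in>J. B j / \<kappa> j)"
    have F_step: "F n z = m n * b z + (F (Suc n) (z - 1) + F (Suc n) (z + 1)) / 2" for n z
    proof -
      have "F n z = (\<Sum>j\<in>J. w j * y j ^ n * (\<kappa> j * b z + y j * ((e j (z - 1) + e j (z + 1)) / 2)))"
        unfolding F_def by (rule sum.cong[OF refl]) (simp only: step[of _ z])
      also have "\<dots> = m n * b z + (F (Suc n) (z - 1) + F (Suc n) (z + 1)) / 2"
        by (simp add: F_def m_def sum_distrib_right sum_divide_distrib
            flip: sum.distrib) (intro sum.cong, simp_all add: field_simps)
      finally show ?thesis .
    qed
    have F_bound: "\<bar>F n z\<bar> \<le> E * m n" for n z
    proof -
      have "\<bar>w j * y j ^ n * e j z\<bar> \<le> E * (w j * \<kappa> j * y j ^ n)" if j: "j \<in> J" for j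
      proof -
        have nn: "0 \<le> w j * y j ^ n" using J(2) y j by (simp add: less_imp_le)
        have B: "0 \<le> B j" if "j \<in> J" for j using bnd[OF that, of 0] by linarith
        have "B j / \<kappa> j \<le> E"
          unfolding E_def by (rule member_le_sum) (use j J B \<kappa> in \<open>auto simp: less_imp_le\<close>)
        then have "\<bar>e j z\<bar> \<le> E * \<kappa> j"
          using bnd[OF j, of z] \<kappa>[OF j] by (simp add: divide_le_eq)
        from mult_left_mono[OF this nn] have "w j * y j ^ n * \<bar>e j z\<bar> \<le> E * (w j * \<kappa> j * y j ^ n)"
          by (simp only: mult_ac)
        moreover have "\<bar>w j * y j ^ n * e j z\<bar> = w j * y j ^ n * \<bar>e j z\<bar>"
          using nn by (simp only: abs_mult[of _ "e j z"] abs_of_nonneg)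
        ultimately show ?thesis by simp
      qed
      then have "(\<Sum>j\<in>J. \<bar>w j * y j ^ n * e j z\<bar>) \<le> E * m n"
        unfolding m_def sum_distrib_left by (rule sum_mono)
      then show ?thesis unfolding F_def using sum_abs by (rule order_trans[rotated])
    qed
    have F0: "F 0 z = (\<Sum>j\<in>J. w j * e j z)" for z by (simp add: F_def)
    have "F 0 z \<le> m 0 * b z + (\<Sum>k\<le>N. g k) * P + 2 * E * m (Suc N)" for z N
      by (rule renewal_bound[OF F_step F_bound less_imp_le[OF m_pos] g0 g_nonneg g_renewal])
        (simp only: F0 P)
    then show ?thesis unfolding F0 by blast
  qed
  \<comment> \<open>The constant functions $\kappa_j / (1 - y_j)$ solve the same resolvent equations, which bounds
    the sums of \<open>g\<close> away from 1.\<close>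
  define H where "H = (\<Sum>j\<in>J. w j * (\<kappa> j / (1 - y j)))"
  have H_pos: "0 < H"
  proof -
    obtain j where j: "j \<in> J" "0 < w j" using J by auto
    show ?thesis unfolding H_def
      by (rule sum_pos2[OF J(1) j(1)]) (use j J \<kappa> y in \<open>auto simp: less_imp_le\<close>)
  qed
  define q where "q = 1 - m 0 / H"
  have q: "(\<Sum>k\<le>N. g k) \<le> q" for N
  proof -
    \<comment> \<open>\<open>key\<close> gives upper bounds only, so the constant solution is
      negated: \<open>b = -1\<close> and \<open>P = -H\<close> turn it into an upper bound for the
      sums of \<open>g\<close>.\<close>
    have "\<exists>E. \<forall>N. \<forall>z::int. (\<Sum>j\<in>J. w j * (- \<kappa> j / (1 - y j))) \<le> m 0 * (- 1) + (\<Sum>k\<le>N. g k) * (- H) + 2 * E * m (Suc N)"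
    proof (rule key[where e = "\<lambda>j z. - \<kappa> j / (1 - y j)" and b = "\<lambda>_. - 1" and P = "- H"
          and B = "\<lambda>j. \<bar>\<kappa> j / (1 - y j)\<bar>"])
      fix j assume "j \<in> J"
      then have "1 - y j \<noteq> 0" using y by force
      have "u = \<kappa> j * - 1 + y j * ((u + u) / 2)" if "u = - \<kappa> j / (1 - y j)" for u
      proof -
        have "u * (1 - y j) = - \<kappa> j" using that \<open>1 - y j \<noteq> 0\<close> by simp
        then show ?thesis by (simp add: algebra_simps)
      qed
      then show "- \<kappa> j / (1 - y j) = \<kappa> j * - 1 + y j * ((- \<kappa> j / (1 - y j) + - \<kappa> j / (1 - y j)) / 2)"
        by blast
    qed (simp_all add: H_def sum_negf)
    then obtain E where E: "\<And>N. - H \<le> - m 0 - (\<Sum>k\<le>N. g k) * H + 2 * E * m (Suc N)"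
      by (auto simp: H_def sum_negf)
    \<comment> \<open>The partial sums of \<open>g\<close> increase, so the index of the error term
      can tend to infinity while \<open>N\<close> stays fixed.\<close>
    have "(\<Sum>k\<le>N. g k) * H \<le> H - m 0 + 2 * E * m (Suc M)" if "N \<le> M" for M
    proof -
      have "(\<Sum>k\<le>N. g k) \<le> (\<Sum>k\<le>M. g k)" by (rule sum_mono2) (use that g_nonneg in auto)
      then have "(\<Sum>k\<le>N. g k) * H \<le> (\<Sum>k\<le>M. g k) * H" using H_pos by simp
      then show ?thesis using E[of M] by simp
    qed
    then have "(\<Sum>k\<le>N. g k) * H \<le> H - m 0 + 0"
      by (intro tendsto_lowerbound[OF tendsto_add[OF tendsto_const m_lim]] eventually_sequentiallyI) auto
    then show ?thesis using H_pos by (simp add: q_def field_simps)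
  qed
  have "0 \<le> q" using q[of 0] g0 by simp
  moreover have "q < 1" using m_pos[of 0] H_pos by (simp add: q_def)
  define b where "b = (\<lambda>z. \<Sum>i\<in>I. \<beta> i * (if z - t i = 0 then 1 else 0))"
  define e where "e = (\<lambda>j z. \<Sum>i\<in>I. \<beta> i * \<rho> j ^ nat \<bar>z - t i\<bar>)"
  have e_step: "e j z = \<kappa> j * b z + y j * ((e j (z - 1) + e j (z + 1)) / 2)" if "j \<in> J" for j z
  proof -
    have "e j z = (\<Sum>i\<in>I. \<beta> i * (\<kappa> j * (if z - t i = 0 then 1 else 0)
        + y j * ((\<rho> j ^ nat \<bar>z - 1 - t i\<bar> + \<rho> j ^ nat \<bar>z + 1 - t i\<bar>) / 2)))"
      unfolding e_def \<kappa>_def y_def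
      by (rule sum.cong[OF refl]) (subst geometric_resolvent, use \<rho> that in \<open>auto simp: algebra_simps\<close>)
    also have "\<dots> = \<kappa> j * b z + y j * ((e j (z - 1) + e j (z + 1)) / 2)"
      by (simp only: e_def b_def sum_distrib_left sum_divide_distrib flip: sum.distrib)
         (intro sum.cong, simp_all add: algebra_simps add_divide_distrib)
    finally show ?thesis .
  qed
  have e_bound: "\<bar>e j z\<bar> \<le> (\<Sum>i\<in>I. \<bar>\<beta> i\<bar>)" if "j \<in> J" for j z
    unfolding e_def
    by (rule order_trans[OF sum_abs], rule sum_mono)
      (use \<rho>[OF that] in \<open>simp add: abs_mult mult_left_le power_le_one less_imp_le\<close>)
  have f_e: "f z = (\<Sum>j\<in>J. w j * e j z)" for z
    unfolding f_def e_def sum_distrib_left by (subst sum.swap) (simp add: mult_ac)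
  \<comment> \<open>\<open>b z\<close> adds the coefficients of all indices with
    \<open>t i = z\<close>; if one of them were positive, the hypothesis would give
    \<open>f z \<le> C\<close>.\<close>
  have b_le: "b z \<le> 0" if "C < f z" for z
    unfolding b_def by (rule sum_nonpos) (use C(2) that in \<open>force simp: not_less[symmetric]\<close>)
  have improve: "f z \<le> max C (q * P)" if P: "\<And>z. f z \<le> P" "0 \<le> P" for P z
  proof (cases "f z \<le> C")
    case False
    obtain E where E: "\<And>N z. f z \<le> m 0 * b z + (\<Sum>k\<le>N. g k) * P + 2 * E * m (Suc N)"
      using key[of e b "\<lambda>_. \<Sum>i\<in>I. \<bar>\<beta> i\<bar>" P] e_step e_bound P unfolding f_e by blast
    have "f z \<le> q * P + 2 * E * m (Suc N)" for N
    proof -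
      have "m 0 * b z \<le> 0" using b_le[of z] False m_pos[of 0] by (simp add: mult_nonneg_nonpos less_imp_le)
      then show ?thesis using E[of z N] mult_right_mono[OF q[of N] P(2)] by linarith
    qed
    then have "f z \<le> q * P + 0"
      by (intro tendsto_lowerbound[OF tendsto_add[OF tendsto_const m_lim]] always_eventually) auto
    then show ?thesis by simp
  qed simp
  define P where "P = (\<Sum>j\<in>J. w j) * (\<Sum>i\<in>I. \<bar>\<beta> i\<bar>)"
  have P0: "0 \<le> P" unfolding P_def using J by (intro mult_nonneg_nonneg sum_nonneg) auto
  have iter: "f z \<le> max C (q ^ n * P)" for n z
  proof (induction n arbitrary: z)
    case 0
    have "f z \<le> P" unfolding f_e P_def sum_distrib_right
      by (intro sum_mono mult_left_mono) (use e_bound J in \<open>force simp: abs_le_iff\<close>)+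
    then show ?case by simp
  next
    case (Suc n)
    have "f z \<le> max C (q * max C (q ^ n * P))"
      by (rule improve) (use Suc C in auto)
    also have "\<dots> \<le> max C (q ^ Suc n * P)"
      using \<open>0 \<le> q\<close> \<open>q < 1\<close> C(1) mult_left_le_one_le[of C q] by (simp add: max_mult_distrib_left mult.assoc)
    finally show ?case .
  qed
  have "(\<lambda>n. max C (q ^ n * P)) \<longlonglongrightarrow> max C (0 * P)"
    by (intro tendsto_intros LIMSEQ_realpow_zero) (use \<open>0 \<le> q\<close> \<open>q < 1\<close> in auto)
  then have "f z \<le> max C (0 * P)"
    by (rule tendsto_lowerbound) (use iter in auto)
  then show ?thesis using C by simp
qed

section \<open>Passage to completely monotone kernels on the real line\<close>

text \<open>For large \<open>n\<close> the hypothesis of the n-th principle holds with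
  \<open>C + \<epsilon>\<close>, uniformly over the finitely many indices.\<close>

lemma max_principle_limit:
  fixes u :: "nat \<Rightarrow> 'i \<Rightarrow> real"
  assumes I: "finite I"
    and max: "\<And>n C. 0 \<le> C \<Longrightarrow> (\<And>i. i \<in> I \<Longrightarrow> 0 < \<beta> i \<Longrightarrow> u n i \<le> C) \<Longrightarrow> v n \<le> C"
    and lim: "\<And>i. i \<in> I \<Longrightarrow> (\<lambda>n. u n i) \<longlonglongrightarrow> U i" "v \<longlonglongrightarrow> V"
    and C: "0 \<le> C" "\<And>i. i \<in> I \<Longrightarrow> 0 < \<beta> i \<Longrightarrow> U i \<le> C"
  shows "V \<le> (C :: real)"
proof (rule field_le_epsilon)
  fix \<epsilon> :: real assume \<epsilon>: "0 < \<epsilon>"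
  have "\<forall>\<^sub>F n in sequentially. \<forall>i\<in>I. 0 < \<beta> i \<longrightarrow> u n i \<le> C + \<epsilon>"
  proof (rule eventually_ball_finite[OF I], rule ballI)
    fix i assume i: "i \<in> I"
    show "\<forall>\<^sub>F n in sequentially. 0 < \<beta> i \<longrightarrow> u n i \<le> C + \<epsilon>"
    proof (cases "0 < \<beta> i")
      case True
      then have "U i < C + \<epsilon>" using C(2)[OF i] \<epsilon> by simp
      from order_tendstoD(2)[OF lim(1)[OF i] this] show ?thesis
        by eventually_elim simp
    qed simp
  qed
  then have "\<forall>\<^sub>F n in sequentially. v n \<le> C + \<epsilon>"
    by eventually_elim (use max C \<epsilon> in auto)
  then show "V \<le> C + \<epsilon>"
    using tendsto_upperbound[OF lim(2)] by simp
qed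

lemma cm_sequence_max:
  fixes s :: "nat \<Rightarrow> real" and t :: "'i \<Rightarrow> int" and \<beta> :: "'i \<Rightarrow> real"
  assumes s: "\<And>j k. 0 \<le> bdiff j s k" "0 < s 0" and I: "finite I"
  defines "f \<equiv> \<lambda>z. \<Sum>i\<in>I. \<beta> i * s (nat \<bar>z - t i\<bar>)"
  assumes C: "0 \<le> C" "\<And>i. i \<in> I \<Longrightarrow> 0 < \<beta> i \<Longrightarrow> f (t i) \<le> C"
  shows "f z \<le> C"
proof -
  define w where "w = (\<lambda>N k. real (N choose k) * bdiff (N - k) s k)"
  define F where "F = (\<lambda>N z. \<Sum>i\<in>I. \<beta> i *
    (\<Sum>k\<le>N. w N k * ((real k + 1) / (real N + 2)) ^ nat \<bar>z - t i\<bar>))"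
  have lim: "(\<lambda>N. F N z) \<longlonglongrightarrow> f z" for z
    unfolding F_def f_def w_def by (intro tendsto_intros hausdorff_approx s)
  show ?thesis
  proof (rule max_principle_limit[where u = "\<lambda>N i. F N (t i)" and v = "\<lambda>N. F N z" and \<beta> = \<beta>, OF I _ lim lim C])
    fix N D assume D: "0 \<le> D" "\<And>i. i \<in> I \<Longrightarrow> 0 < \<beta> i \<Longrightarrow> F N (t i) \<le> D"
    have w: "0 \<le> w N k" for k by (simp add: w_def s)
    \<comment> \<open>The mixture needs at least one positive weight, which the positive total mass
      \<open>s 0\<close> provides.\<close>
    have "(\<Sum>k\<le>N. w N k) = s 0"
      using hausdorff_sum[of N s 0] by (simp add: w_def)
    then have "\<exists>k\<in>{..N}. 0 < w N k"
      using s(2) by (metis not_less sum_nonpos)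
    then show "F N z \<le> D"
      unfolding F_def
    proof (rule geometric_mixture_max[where \<rho> = "\<lambda>k. (real k + 1) / (real N + 2)", rotated 2])
      fix i assume "i \<in> I" "0 < \<beta> i"
      from D(2)[OF this] show "(\<Sum>i'\<in>I. \<beta> i' *
        (\<Sum>k\<le>N. w N k * ((real k + 1) / (real N + 2)) ^ nat \<bar>t i - t i'\<bar>)) \<le> D"
        unfolding F_def .
    qed (use w I D in auto)
  qed
qed

lemma floor_grid_tendsto: "(\<lambda>L. of_int \<lfloor>x * real (Suc L)\<rfloor> / real (Suc L)) \<longlonglongrightarrow> x"
proof -
  have "(\<lambda>L. of_int \<lfloor>x * real (Suc L)\<rfloor> / real (Suc L) - x) \<longlonglongrightarrow> 0"
  proof (rule Lim_null_comparison[OF always_eventually LIMSEQ_inverse_real_of_nat], rule allI)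
    fix L
    have "\<bar>of_int \<lfloor>x * real (Suc L)\<rfloor> - x * real (Suc L)\<bar> \<le> 1"
      by linarith
    moreover have "of_int \<lfloor>x * real (Suc L)\<rfloor> / real (Suc L) - x
      = (of_int \<lfloor>x * real (Suc L)\<rfloor> - x * real (Suc L)) / real (Suc L)"
      by (simp add: diff_divide_distrib)
    ultimately show "norm (of_int \<lfloor>x * real (Suc L)\<rfloor> / real (Suc L) - x) \<le> inverse (real (Suc L))"
      by (simp only: real_norm_def abs_divide abs_of_nat)
        (simp add: inverse_eq_divide divide_right_mono del: of_nat_Suc)
  qed
  then show ?thesis by (simp only: LIM_zero_iff)
qed

text \<open>Points are rounded down to the grid of mesh \<open>1 / (L + 1)\<close>, on which the
  kernel is a completely monotone sequence, and continuity of \<open>\<psi>\<close> gives the limit.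
  Distinct points may share a grid point, which is why the integer versions take an indexed family
  \<open>t\<close> instead of a set.\<close>

lemma cm_kernel_max:
  fixes \<psi> :: "real \<Rightarrow> real" and S :: "real set"
  assumes \<psi>: "continuous_on {0..} \<psi>" "0 < \<psi> 0"
    and cm: "\<And>h j k. 0 < h \<Longrightarrow> 0 \<le> bdiff j (\<lambda>k. \<psi> (real k * h)) k"
    and S: "finite S"
    and C: "0 \<le> C" "\<And>\<theta>. \<theta> \<in> S \<Longrightarrow> 0 < \<beta> \<theta> \<Longrightarrow> (\<Sum>\<eta>\<in>S. \<beta> \<eta> * \<psi> \<bar>\<theta> - \<eta>\<bar>) \<le> C"
  shows "(\<Sum>\<eta>\<in>S. \<beta> \<eta> * \<psi> \<bar>z - \<eta>\<bar>) \<le> C"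
proof -
  define g where "g = (\<lambda>L x. \<lfloor>x * real (Suc L)\<rfloor>)"
  define F where "F = (\<lambda>L z. \<Sum>\<eta>\<in>S. \<beta> \<eta> * \<psi> (real (nat \<bar>g L z - g L \<eta>\<bar>) * (1 / real (Suc L))))"
  have lim: "(\<lambda>L. F L z) \<longlonglongrightarrow> (\<Sum>\<eta>\<in>S. \<beta> \<eta> * \<psi> \<bar>z - \<eta>\<bar>)" for z
    unfolding F_def
  proof (intro tendsto_intros continuous_on_tendsto_compose[OF \<psi>(1)])
    fix \<eta>
    have "(\<lambda>L. \<bar>of_int (g L z) / real (Suc L) - of_int (g L \<eta>) / real (Suc L)\<bar>) \<longlonglongrightarrow> \<bar>z - \<eta>\<bar>"
      unfolding g_def by (intro tendsto_intros floor_grid_tendsto)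
    also have "(\<lambda>L. \<bar>of_int (g L z) / real (Suc L) - of_int (g L \<eta>) / real (Suc L)\<bar>)
      = (\<lambda>L. real (nat \<bar>g L z - g L \<eta>\<bar>) * (1 / real (Suc L)))"
      by (simp flip: diff_divide_distrib of_int_diff)
    finally show "(\<lambda>L. real (nat \<bar>g L z - g L \<eta>\<bar>) * (1 / real (Suc L))) \<longlonglongrightarrow> \<bar>z - \<eta>\<bar>" .
  qed auto
  show ?thesis
  proof (rule max_principle_limit[where u = F and v = "\<lambda>L. F L z" and \<beta> = \<beta>, OF S _ lim lim C])
    fix L D assume D: "0 \<le> D" "\<And>\<theta>. \<theta> \<in> S \<Longrightarrow> 0 < \<beta> \<theta> \<Longrightarrow> F L \<theta> \<le> D"
    show "F L z \<le> D"
      unfolding F_def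
    proof (rule cm_sequence_max[where s = "\<lambda>n. \<psi> (real n * (1 / real (Suc L)))" and t = "g L"])
      show "0 \<le> bdiff j (\<lambda>n. \<psi> (real n * (1 / real (Suc L)))) k" for j k
        by (rule cm) simp
      fix \<theta> assume "\<theta> \<in> S" "0 < \<beta> \<theta>"
      from D(2)[OF this]
      show "(\<Sum>\<eta>\<in>S. \<beta> \<eta> * \<psi> (real (nat \<bar>g L \<theta> - g L \<eta>\<bar>) * (1 / real (Suc L)))) \<le> D"
        unfolding F_def .
    qed (use S \<psi>(2) D(1) in simp_all)
  qed
qed

subsection \<open>Dictionaries and orthogonal matching pursuit\<close>

text \<open>A Gram-Schmidt step: \<open>a s\<close> is replaced by its component \<open>r\<close>
  orthogonal to the other atoms, and the projection onto \<open>r\<close> is added.\<close>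

lemma exists_orthogonal_residual:
  fixes a :: "'i \<Rightarrow> 'h::real_inner"
  assumes "finite S"
  shows "\<exists>g. \<forall>\<theta>\<in>S. inner (v - (\<Sum>\<eta>\<in>S. g \<eta> *\<^sub>R a \<eta>)) (a \<theta>) = 0"
  using assms
proof (induction S arbitrary: v)
  case (insert s S)
  obtain e where e: "\<And>\<theta>. \<theta> \<in> S \<Longrightarrow> inner (a s - (\<Sum>\<eta>\<in>S. e \<eta> *\<^sub>R a \<eta>)) (a \<theta>) = 0"
    using insert.IH[of "a s"] by blast
  obtain g where g: "\<And>\<theta>. \<theta> \<in> S \<Longrightarrow> inner (v - (\<Sum>\<eta>\<in>S. g \<eta> *\<^sub>R a \<eta>)) (a \<theta>) = 0"
    using insert.IH[of v] by blast
  define r where "r = a s - (\<Sum>\<eta>\<in>S. e \<eta> *\<^sub>R a \<eta>)"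
  define u where "u = v - (\<Sum>\<eta>\<in>S. g \<eta> *\<^sub>R a \<eta>)"
  \<comment> \<open>If \<open>a s\<close> lies in the span of the others, then \<open>r = 0\<close>
    and division by zero gives \<open>c = 0\<close>.\<close>
  define c where "c = inner u r / inner r r"
  define g' where "g' = (\<lambda>\<eta>. if \<eta> = s then c else g \<eta> - c * e \<eta>)"
  have "(\<Sum>\<eta>\<in>S. g' \<eta> *\<^sub>R a \<eta>) = (\<Sum>\<eta>\<in>S. g \<eta> *\<^sub>R a \<eta>) - c *\<^sub>R (\<Sum>\<eta>\<in>S. e \<eta> *\<^sub>R a \<eta>)"
    unfolding scaleR_sum_right sum_subtractf[symmetric]
    by (rule sum.cong) (use insert.hyps in \<open>auto simp: g'_def scaleR_diff_left\<close>)
  then have eq: "v - (\<Sum>\<eta>\<in>insert s S. g' \<eta> *\<^sub>R a \<eta>) = u - c *\<^sub>R r"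
    using insert.hyps by (simp add: g'_def u_def r_def algebra_simps)
  have u_orth: "inner u (a \<theta>) = 0" and r_orth: "inner r (a \<theta>) = 0" if "\<theta> \<in> S" for \<theta>
    using e g that by (auto simp: u_def r_def)
  have "inner w (a s) = inner w r" if "\<And>\<theta>. \<theta> \<in> S \<Longrightarrow> inner w (a \<theta>) = 0" for w
    using that by (simp add: r_def inner_diff_right inner_sum_right)
  then have "inner (u - c *\<^sub>R r) (a s) = inner (u - c *\<^sub>R r) r"
    using u_orth r_orth by (simp add: inner_diff_left)
  also have "\<dots> = 0" by (simp add: c_def inner_diff_left)
  finally show ?case
    using u_orth r_orth by (intro exI[of _ g']) (simp add: eq inner_diff_left)
qed simp

text \<open>Inside this locale complete monotonicity acts only through nonnegativity, midpoint
  convexity and the maximum principle.\<close>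

locale cm_dictionary =
  fixes a :: "real \<Rightarrow> 'h::real_inner" and \<psi> :: "real \<Rightarrow> real"
  assumes inner_a: "inner (a x) (a y) = \<psi> \<bar>x - y\<bar>"
    and zero: "\<psi> 0 = 1"
    and at_zero: "(\<psi> \<longlongrightarrow> 1) (at_right 0)"
    and at_infinity: "(\<psi> \<longlongrightarrow> 0) at_top"
    and nonneg: "0 \<le> x \<Longrightarrow> 0 \<le> \<psi> x"
    and midconvex: "0 \<le> d \<Longrightarrow> d \<le> t \<Longrightarrow> 2 * \<psi> t \<le> \<psi> (t - d) + \<psi> (t + d)"
    and max_principle: "finite S \<Longrightarrow> 0 \<le> C \<Longrightarrow>
      (\<And>\<theta>. \<theta> \<in> S \<Longrightarrow> 0 < \<beta> \<theta> \<Longrightarrow> inner (\<Sum>\<eta>\<in>S. \<beta> \<eta> *\<^sub>R a \<eta>) (a \<theta>) \<le> C) \<Longrightarrow>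
      inner (\<Sum>\<eta>\<in>S. \<beta> \<eta> *\<^sub>R a \<eta>) (a z) \<le> C"
begin

section \<open>Positivity of the kernel and independence of the atoms\<close>

lemma progression_tendsto: "0 < d \<Longrightarrow> (\<lambda>n. \<psi> (x + real n * d)) \<longlonglongrightarrow> 0"
  by (rule filterlim_compose[OF at_infinity]) real_asymp

text \<open>A zero at \<open>y\<close> propagates to \<open>y / 2\<close>: the combination
  \<open>\<psi> (y / 2) *\<^sub>R a (y / 2) - a y\<close> has value 0 at its only possibly positive
  atom, so its value \<open>(\<psi> (y / 2))^2\<close> at 0 is at most 0. Repeated halving
  contradicts the limit 1 at 0.\<close>

lemma pos:
  assumes "0 \<le> x"
  shows "0 < \<psi> x"
proof (rule ccontr)
  assume "\<not> 0 < \<psi> x"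
  then have x: "\<psi> x = 0" "0 < x" using assms nonneg[of x] zero by (auto simp: less_le)
  have half: "\<psi> (y / 2) = 0" if "\<psi> y = 0" "0 < y" for y
  proof -
    define \<beta> where "\<beta> = (\<lambda>\<eta>. if \<eta> = y then - 1 else \<psi> (y / 2))"
    have v: "(\<Sum>\<eta>\<in>{y / 2, y}. \<beta> \<eta> *\<^sub>R a \<eta>) = \<psi> (y / 2) *\<^sub>R a (y / 2) - a y"
      using that by (simp add: \<beta>_def)
    have "inner (\<Sum>\<eta>\<in>{y / 2, y}. \<beta> \<eta> *\<^sub>R a \<eta>) (a 0) \<le> 0"
    proof (rule max_principle)
      fix \<theta> assume "\<theta> \<in> {y / 2, y}" "0 < \<beta> \<theta>"
      then have \<theta>: "\<theta> = y / 2" by (auto simp: \<beta>_def split: if_splits)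
      show "inner (\<Sum>\<eta>\<in>{y / 2, y}. \<beta> \<eta> *\<^sub>R a \<eta>) (a \<theta>) \<le> 0"
        unfolding v \<theta> using that by (simp add: inner_diff_left inner_a zero)
    qed auto
    then show ?thesis
      unfolding v using that by (simp add: inner_diff_left inner_a flip: power2_eq_square)
  qed
  have "\<psi> (x / 2 ^ n) = 0" for n
  proof (induction n)
    case (Suc n)
    then show ?case using half[of "x / 2 ^ n"] x by (simp add: mult.commute)
  qed (simp add: x)
  moreover have "(\<lambda>n. \<psi> (x / 2 ^ n)) \<longlonglongrightarrow> 1"
    by (rule filterlim_compose[OF at_zero]) (use x in real_asymp)
  ultimately show False by (simp add: LIMSEQ_const_iff)
qed

text \<open>Otherwise midpoint convexity makes \<open>\<psi>\<close> nondecreasing along the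
  multiples of \<open>t\<close>, starting from the value 1, which contradicts the limit 0 at
  infinity.\<close>

lemma less_one:
  assumes "0 < t"
  shows "\<psi> t < 1"
proof (rule ccontr)
  assume "\<not> \<psi> t < 1"
  then have t: "1 \<le> \<psi> t" by simp
  let ?u = "\<lambda>n. \<psi> (real n * t)"
  have "?u n \<le> ?u (Suc n)" for n
  proof (induction n)
    case 0
    then show ?case using t zero by simp
  next
    case (Suc n)
    have "2 * \<psi> (real (Suc n) * t) \<le> \<psi> (real (Suc n) * t - t) + \<psi> (real (Suc n) * t + t)"
      by (rule midconvex) (use assms in \<open>auto simp: algebra_simps\<close>)
    then show ?case using Suc by (simp add: algebra_simps)
  qed
  then have "incseq ?u" by (rule incseq_SucI)
  then have "?u 0 \<le> 0"
    using incseq_le[of ?u 0 0] progression_tendsto[OF assms, of 0] by simp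
  then show False using zero by simp
qed

text \<open>A relation with \<open>\<beta> j \<noteq> 0\<close> lets \<open>a j\<close> be written
  with coefficient -1 at \<open>j\<close>; the factor \<open>2 / \<beta> j\<close> achieves this.
  Positive coefficients then sit at other atoms, where \<open>a j\<close> has correlation at most
  \<open>C < 1\<close>, while its value at \<open>j\<close> is 1.\<close>

lemma independent:
  assumes S: "finite S" and sum0: "(\<Sum>\<eta>\<in>S. \<beta> \<eta> *\<^sub>R a \<eta>) = 0" and j: "j \<in> S"
  shows "\<beta> j = 0"
proof (rule ccontr)
  assume nz: "\<beta> j \<noteq> 0"
  define \<gamma> where "\<gamma> = (\<lambda>\<eta>. (if \<eta> = j then 1 else 0) - 2 / \<beta> j * \<beta> \<eta>)"
  define C where "C = Max (insert 0 ((\<lambda>\<theta>. \<psi> \<bar>j - \<theta>\<bar>) ` (S - {j})))"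
  have "(\<Sum>\<eta>\<in>S. \<gamma> \<eta> *\<^sub>R a \<eta>) = (\<Sum>\<eta>\<in>S. (if \<eta> = j then a \<eta> else 0)) - (2 / \<beta> j) *\<^sub>R (\<Sum>\<eta>\<in>S. \<beta> \<eta> *\<^sub>R a \<eta>)"
    unfolding scaleR_sum_right sum_subtractf[symmetric]
    by (rule sum.cong) (auto simp: \<gamma>_def scaleR_diff_left)
  then have v: "(\<Sum>\<eta>\<in>S. \<gamma> \<eta> *\<^sub>R a \<eta>) = a j"
    using S j sum0 by simp
  have "inner (\<Sum>\<eta>\<in>S. \<gamma> \<eta> *\<^sub>R a \<eta>) (a j) \<le> C"
  proof (rule max_principle[OF S])
    show "0 \<le> C" unfolding C_def using S by (intro Max_ge) auto
    fix \<theta> assume \<theta>: "\<theta> \<in> S" "0 < \<gamma> \<theta>"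
    then have "\<theta> \<noteq> j" using nz by (auto simp: \<gamma>_def)
    then have "\<psi> \<bar>j - \<theta>\<bar> \<le> C" unfolding C_def using S \<theta> by (intro Max_ge) auto
    then show "inner (\<Sum>\<eta>\<in>S. \<gamma> \<eta> *\<^sub>R a \<eta>) (a \<theta>) \<le> C" unfolding v inner_a .
  qed
  moreover have "C < 1" unfolding C_def using S by (auto simp: less_one)
  ultimately show False unfolding v by (simp add: inner_a zero)
qed

section \<open>Projection of an atom onto the span of finitely many others\<close>

context
  fixes S :: "real set" and x :: real and g :: "real \<Rightarrow> real" and h :: 'h
  assumes S: "finite S" and x: "x \<notin> S"
    and h_def: "h = a x - (\<Sum>\<eta>\<in>S. g \<eta> *\<^sub>R a \<eta>)"
    and orth: "\<And>\<theta>. \<theta> \<in> S \<Longrightarrow> inner h (a \<theta>) = 0"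
begin

text \<open>In \<open>- h\<close> the coefficient at \<open>x\<close> is -1, so positive
  coefficients occur only on \<open>S\<close>, where the correlations with \<open>h\<close> vanish;
  the maximum principle applies with \<open>C = 0\<close>.\<close>

lemma residual_nonneg: "0 \<le> inner h (a z)"
proof -
  define \<gamma> where "\<gamma> = (\<lambda>\<eta>. if \<eta> = x then - 1 else g \<eta>)"
  have "(\<Sum>\<eta>\<in>S. \<gamma> \<eta> *\<^sub>R a \<eta>) = (\<Sum>\<eta>\<in>S. g \<eta> *\<^sub>R a \<eta>)"
    by (rule sum.cong) (use x in \<open>auto simp: \<gamma>_def\<close>)
  then have v: "(\<Sum>\<eta>\<in>insert x S. \<gamma> \<eta> *\<^sub>R a \<eta>) = - h"
    using S x by (simp add: h_def \<gamma>_def)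
  have "inner (\<Sum>\<eta>\<in>insert x S. \<gamma> \<eta> *\<^sub>R a \<eta>) (a z) \<le> 0"
  proof (rule max_principle)
    fix \<theta> assume "\<theta> \<in> insert x S" "0 < \<gamma> \<theta>"
    then have "\<theta> \<in> S" by (auto simp: \<gamma>_def split: if_splits)
    then show "inner (\<Sum>\<eta>\<in>insert x S. \<gamma> \<eta> *\<^sub>R a \<eta>) (a \<theta>) \<le> 0"
      unfolding v using orth by simp
  qed (use S in auto)
  then show ?thesis unfolding v by simp
qed

text \<open>If $g_i < 0$, subtracting a large multiple of $h$ from the residual $k$ of $a(i)$ with respect to
  the other atoms produces a negative coefficient at $i$ without changing the value at $i$, the only
  positive value on the atoms involved; this contradicts the maximum principle.\<close>
lemma projection_coeff_nonneg:
  assumes i: "i \<in> S"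
  shows "0 \<le> g i"
proof (rule ccontr)
  assume "\<not> 0 \<le> g i"
  then have gi: "g i < 0" by simp
  define U where "U = insert x (S - {i})"
  have U: "finite U" "i \<notin> U" using S i x by (auto simp: U_def)
  obtain e where e: "\<And>\<theta>. \<theta> \<in> U \<Longrightarrow> inner (a i - (\<Sum>\<eta>\<in>U. e \<eta> *\<^sub>R a \<eta>)) (a \<theta>) = 0"
    using exists_orthogonal_residual[OF U(1), of "a i" a] by blast
  define k where "k = a i - (\<Sum>\<eta>\<in>U. e \<eta> *\<^sub>R a \<eta>)"
  have k_orth: "inner k (a \<theta>) = 0" if "\<theta> \<in> U" for \<theta>
    using e[OF that] by (simp add: k_def)
  have "k \<noteq> 0"
  proof
    assume "k = 0"
    let ?\<beta> = "\<lambda>\<eta>. if \<eta> = i then - 1 else e \<eta>"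
    have "(\<Sum>\<eta>\<in>U. ?\<beta> \<eta> *\<^sub>R a \<eta>) = (\<Sum>\<eta>\<in>U. e \<eta> *\<^sub>R a \<eta>)"
      by (rule sum.cong) (use U in auto)
    then have "(\<Sum>\<eta>\<in>insert i U. ?\<beta> \<eta> *\<^sub>R a \<eta>) = - k"
      using U by (simp add: k_def)
    with \<open>k = 0\<close> show False
      using independent[of "insert i U" ?\<beta> i] U by simp
  qed
  have "inner k (a i) = inner k k"
    using k_orth by (simp add: k_def[THEN arg_cong, of "inner k"] inner_diff_right inner_sum_right)
  then have k_pos: "0 < inner k (a i)" using \<open>k \<noteq> 0\<close> by simp
  \<comment> \<open>This choice makes the coefficient at \<open>i\<close>, namely
    \<open>1 + T * g i\<close>, equal to -1.\<close>
  define T where "T = - 2 / g i"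
  have T: "0 < T" "T * g i = - 2" using gi by (simp_all add: T_def)
  define \<gamma> where "\<gamma> = (\<lambda>\<eta>. (if \<eta> = i then 1 else - e \<eta>) + T * (if \<eta> = x then - 1 else g \<eta>))"
  have ins: "insert x S = insert i U" using i by (auto simp: U_def)
  have "(\<Sum>\<eta>\<in>insert x S. \<gamma> \<eta> *\<^sub>R a \<eta>) =
      (\<Sum>\<eta>\<in>insert i U. (if \<eta> = i then 1 else - e \<eta>) *\<^sub>R a \<eta>)
      + T *\<^sub>R (\<Sum>\<eta>\<in>insert x S. (if \<eta> = x then - 1 else g \<eta>) *\<^sub>R a \<eta>)"
    unfolding ins[symmetric] scaleR_sum_right sum.distrib[symmetric]
    by (rule sum.cong) (simp_all only: \<gamma>_def scaleR_add_left scaleR_scaleR)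
  also have "(\<Sum>\<eta>\<in>insert i U. (if \<eta> = i then 1 else - e \<eta>) *\<^sub>R a \<eta>) = k"
  proof -
    have "(\<Sum>\<eta>\<in>U. (if \<eta> = i then 1 else - e \<eta>) *\<^sub>R a \<eta>) = - (\<Sum>\<eta>\<in>U. e \<eta> *\<^sub>R a \<eta>)"
      unfolding sum_negf[symmetric] by (rule sum.cong) (use U in auto)
    then show ?thesis using U by (simp add: k_def)
  qed
  also have "(\<Sum>\<eta>\<in>insert x S. (if \<eta> = x then - 1 else g \<eta>) *\<^sub>R a \<eta>) = - h"
  proof -
    have "(\<Sum>\<eta>\<in>S. (if \<eta> = x then - 1 else g \<eta>) *\<^sub>R a \<eta>) = (\<Sum>\<eta>\<in>S. g \<eta> *\<^sub>R a \<eta>)"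
      by (rule sum.cong) (use x in auto)
    then show ?thesis using S x by (simp add: h_def)
  qed
  finally have v: "(\<Sum>\<eta>\<in>insert x S. \<gamma> \<eta> *\<^sub>R a \<eta>) = k - T *\<^sub>R h" by simp
  have "inner (\<Sum>\<eta>\<in>insert x S. \<gamma> \<eta> *\<^sub>R a \<eta>) (a i) \<le> 0"
  proof (rule max_principle)
    fix \<theta> assume \<theta>: "\<theta> \<in> insert x S" "0 < \<gamma> \<theta>"
    have "\<gamma> i = - 1" using i x T by (auto simp: \<gamma>_def)
    then have "\<theta> \<noteq> i" using \<theta> by auto
    then have "inner k (a \<theta>) = 0" using \<theta> by (intro k_orth) (auto simp: U_def)
    moreover have "0 \<le> inner h (a \<theta>)" by (rule residual_nonneg)
    ultimately show "inner (\<Sum>\<eta>\<in>insert x S. \<gamma> \<eta> *\<^sub>R a \<eta>) (a \<theta>) \<le> 0"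
      unfolding v using T by (simp add: inner_diff_left)
  qed (use S in auto)
  then show False
    unfolding v using k_pos orth[OF i] by (simp add: inner_diff_left)
qed

lemma projection_coeff_sum_less_one: "(\<Sum>\<eta>\<in>S. g \<eta>) < 1"
proof (rule ccontr)
  assume "\<not> (\<Sum>\<eta>\<in>S. g \<eta>) < 1"
  then have ge: "1 \<le> (\<Sum>\<eta>\<in>S. g \<eta>)" by simp
  then obtain i where i: "i \<in> S" "g i \<noteq> 0"
    by (metis sum.neutral not_one_le_zero)
  \<comment> \<open>Evaluating the nonnegative function $\langle h, a(\cdot)\rangle$ at $x \pm t$ for large $t$ forces
    equality in the midpoint convexity of \<open>\<psi>\<close>, so \<open>\<psi>\<close> is affine along a progression.\<close>
  define d where "d = (\<lambda>\<eta>. \<bar>x - \<eta>\<bar>)"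
  \<comment> \<open>For \<open>t \<ge> D\<close> the points \<open>x + t\<close> and
    \<open>x - t\<close> enclose all of \<open>S\<close>, and their distances to
    \<open>\<eta>\<close> are \<open>t - d \<eta>\<close> and \<open>t + d \<eta>\<close> in some
    order.\<close>
  define D where "D = (\<Sum>\<eta>\<in>S. d \<eta>)"
  have d_le: "d \<eta> \<le> D" if "\<eta> \<in> S" for \<eta>
    unfolding D_def by (rule member_le_sum) (use S that in \<open>auto simp: d_def\<close>)
  have d_pos: "0 < d i" using i x by (auto simp: d_def)
  have lin: "\<psi> (t - d i) + \<psi> (t + d i) = 2 * \<psi> t" if t: "D \<le> t" for t
  proof -
    let ?c = "\<lambda>\<eta>. \<psi> (t - d \<eta>) + \<psi> (t + d \<eta>) - 2 * \<psi> t"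
    have dt: "d \<eta> \<le> t" if "\<eta> \<in> S" for \<eta> using d_le[OF that] t by simp
    have t0: "0 \<le> t" using dt[OF i(1)] d_pos by simp
    have c: "0 \<le> ?c \<eta>" if "\<eta> \<in> S" for \<eta>
      using midconvex[OF _ dt[OF that]] by (simp add: d_def)
    have "inner (a \<eta>) (a (x + t)) + inner (a \<eta>) (a (x - t)) = \<psi> (t - d \<eta>) + \<psi> (t + d \<eta>)"
      if "\<eta> \<in> S" for \<eta>
    proof (cases "\<eta> \<le> x")
      case True
      then have "\<bar>\<eta> - (x + t)\<bar> = t + d \<eta>" "\<bar>\<eta> - (x - t)\<bar> = t - d \<eta>"
        using dt[OF that] t0 by (auto simp: d_def)
      then show ?thesis by (simp add: inner_a)
    next
      case False
      then have "\<bar>\<eta> - (x + t)\<bar> = t - d \<eta>" "\<bar>\<eta> - (x - t)\<bar> = t + d \<eta>"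
        using dt[OF that] t0 by (auto simp: d_def)
      then show ?thesis by (simp add: inner_a)
    qed
    then have "(\<Sum>\<eta>\<in>S. g \<eta> * (inner (a \<eta>) (a (x + t)) + inner (a \<eta>) (a (x - t))))
        = (\<Sum>\<eta>\<in>S. g \<eta> * (?c \<eta> + 2 * \<psi> t))"
      by (intro sum.cong) auto
    also have "\<dots> = (\<Sum>\<eta>\<in>S. g \<eta> * ?c \<eta>) + (\<Sum>\<eta>\<in>S. g \<eta>) * (2 * \<psi> t)"
      by (simp only: ring_distribs(1) sum.distrib sum_distrib_right)
    finally have "inner h (a (x + t)) + inner h (a (x - t))
        = 2 * \<psi> t - ((\<Sum>\<eta>\<in>S. g \<eta> * ?c \<eta>) + (\<Sum>\<eta>\<in>S. g \<eta>) * (2 * \<psi> t))"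
      using t0 by (simp add: h_def inner_diff_left inner_sum_left inner_a[of x] ring_distribs(1) sum.distrib)
    moreover have "1 * (2 * \<psi> t) \<le> (\<Sum>\<eta>\<in>S. g \<eta>) * (2 * \<psi> t)"
      by (rule mult_right_mono[OF ge]) (use nonneg[OF t0] in simp)
    ultimately have "(\<Sum>\<eta>\<in>S. g \<eta> * ?c \<eta>) \<le> 0"
      using residual_nonneg[of "x + t"] residual_nonneg[of "x - t"] by linarith
    moreover have gc: "0 \<le> g \<eta> * ?c \<eta>" if "\<eta> \<in> S" for \<eta>
      using projection_coeff_nonneg[OF that] c[OF that] by (rule mult_nonneg_nonneg)
    ultimately have "(\<Sum>\<eta>\<in>S. g \<eta> * ?c \<eta>) = 0"
      using sum_nonneg[of S "\<lambda>\<eta>. g \<eta> * ?c \<eta>", OF gc] by linarith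
    then have "g i * ?c i = 0"
      using sum_nonneg_eq_0_iff[OF S, of "\<lambda>\<eta>. g \<eta> * ?c \<eta>"] gc i by blast
    then show ?thesis using i by simp
  qed
  let ?u = "\<lambda>n. \<psi> (D + real n * d i)"
  have u_lim: "?u \<longlonglongrightarrow> 0" by (rule progression_tendsto[OF d_pos])
  \<comment> \<open>Constant increments of a convergent sequence vanish, so the sequence equals its
    limit 0 throughout; this contradicts the positivity of \<open>\<psi> D\<close>.\<close>
  have "?u (Suc n) - ?u n = ?u 1 - ?u 0" for n
  proof (induction n)
    case (Suc n)
    have "D \<le> D + real (Suc n) * d i" using d_pos by simp
    from lin[OF this] Suc show ?case by (simp add: algebra_simps)
  qed simp
  moreover have "(\<lambda>n. ?u (Suc n) - ?u n) \<longlonglongrightarrow> 0 - 0"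
    by (intro tendsto_diff u_lim LIMSEQ_Suc[OF u_lim])
  ultimately have "?u 1 - ?u 0 = 0" and step: "\<And>n. ?u (Suc n) - ?u n = ?u 1 - ?u 0"
    by (simp_all only: LIMSEQ_const_iff)
  then have "?u (Suc n) = ?u n" for n by (metis eq_iff_diff_eq_0)
  then have "?u n = ?u 0" for n by (induction n) simp_all
  then have "?u = (\<lambda>_. \<psi> D)" by (intro ext) simp
  with u_lim have "\<psi> D = 0" by (simp add: LIMSEQ_const_iff)
  moreover have "0 \<le> D" using d_le[OF i(1)] d_pos by simp
  ultimately show False using pos[of D] by simp
qed

end

section \<open>Greedy selection and termination\<close>

text \<open>Since \<open>r\<close> lies in the span, only the projection of \<open>a x\<close>
  contributes to \<open>inner (a x) r\<close>. For \<open>x\<close> outside \<open>S\<close> this is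
  a combination of the correlations on \<open>S\<close> with nonnegative coefficients of sum less
  than 1, hence strictly below the maximum.\<close>

lemma maximizer_in_support:
  assumes S: "finite S" and r: "r = (\<Sum>\<eta>\<in>S. \<beta> \<eta> *\<^sub>R a \<eta>)" "r \<noteq> 0"
    and max: "\<And>\<theta>. \<bar>inner (a \<theta>) r\<bar> \<le> \<bar>inner (a x) r\<bar>"
  shows "x \<in> S"
proof (rule ccontr)
  assume x: "x \<notin> S"
  let ?M = "\<bar>inner (a x) r\<bar>"
  obtain g where g: "\<And>\<theta>. \<theta> \<in> S \<Longrightarrow> inner (a x - (\<Sum>\<eta>\<in>S. g \<eta> *\<^sub>R a \<eta>)) (a \<theta>) = 0"
    using exists_orthogonal_residual[OF S, of "a x" a] by blast
  \<comment> \<open>Strictness needs a positive maximum: a vector in the span that is orthogonal to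
    all atoms is zero.\<close>
  have M: "0 < ?M"
  proof (rule ccontr)
    assume "\<not> 0 < ?M"
    then have "inner (a \<theta>) r = 0" for \<theta> using max[of \<theta>] by simp
    then have "inner r r = 0" by (subst (1) r(1)) (simp add: inner_sum_left)
    then show False using r(2) by simp
  qed
  have "inner (a x - (\<Sum>\<eta>\<in>S. g \<eta> *\<^sub>R a \<eta>)) r = 0"
    unfolding r(1) inner_sum_right using g by (intro sum.neutral) simp
  then have "inner (a x) r = (\<Sum>\<eta>\<in>S. g \<eta> * inner (a \<eta>) r)"
    by (simp add: inner_diff_left inner_sum_left)
  also have "\<bar>\<dots>\<bar> \<le> (\<Sum>\<eta>\<in>S. g \<eta> * ?M)"
    by (rule order_trans[OF sum_abs], rule sum_mono)
      (simp add: abs_mult projection_coeff_nonneg[OF S x refl g] max mult_left_mono)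
  also have "\<dots> = (\<Sum>\<eta>\<in>S. g \<eta>) * ?M" by (simp only: sum_distrib_right)
  also have "\<dots> < 1 * ?M"
    using M projection_coeff_sum_less_one[OF S x refl g] by (intro mult_strict_right_mono)
  finally show False by simp
qed

text \<open>The form of the residual keeps the next greedy choice inside \<open>S\<close>. The
  vanishing of \<open>b\<close> off the selection serves the end of the run, where it forces every
  atom of the support to have been selected.\<close>

lemma omp_run_support:
  assumes S: "finite S" and run: "omp_run a (\<Sum>\<theta>\<in>S. c \<theta> *\<^sub>R a \<theta>) sel r"
  shows "set sel \<subseteq> S \<and> (\<exists>b. r = (\<Sum>\<theta>\<in>S. c \<theta> *\<^sub>R a \<theta>) - (\<Sum>\<theta>\<in>S. b \<theta> *\<^sub>R a \<theta>)
    \<and> (\<forall>\<theta>\<in>S - set sel. b \<theta> = 0))"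
  using run
proof induction
  case init
  then show ?case by (intro conjI exI[of _ "\<lambda>_. 0"]) auto
next
  case (step sel r \<theta> c')
  then obtain b where "r = (\<Sum>\<theta>\<in>S. c \<theta> *\<^sub>R a \<theta>) - (\<Sum>\<theta>\<in>S. b \<theta> *\<^sub>R a \<theta>)" by blast
  then have "r = (\<Sum>\<theta>\<in>S. (c \<theta> - b \<theta>) *\<^sub>R a \<theta>)"
    by (simp add: scaleR_diff_left sum_subtractf)
  from maximizer_in_support[OF S this] step.hyps have "\<theta> \<in> S" by blast
  then have sub: "set (sel @ [\<theta>]) \<subseteq> S" using step.IH by simp
  let ?sel = "sel @ [\<theta>]"
  \<comment> \<open>Coefficients are collected over all positions holding the same atom, since a
    list may repeat an entry.\<close>
  define b' where "b' = (\<lambda>\<eta>. \<Sum>l\<in>{l \<in> {..<length ?sel}. ?sel ! l = \<eta>}. c' l)"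
  have mem: "?sel ! l \<in> S" if "l < length ?sel" for l
    using sub nth_mem[OF that] by blast
  have "(\<Sum>\<eta>\<in>S. b' \<eta> *\<^sub>R a \<eta>)
      = (\<Sum>\<eta>\<in>S. \<Sum>l\<in>{l \<in> {..<length ?sel}. ?sel ! l = \<eta>}. c' l *\<^sub>R a (?sel ! l))"
    unfolding b'_def scaleR_sum_left by (intro sum.cong) auto
  also have "\<dots> = (\<Sum>l<length ?sel. c' l *\<^sub>R a (?sel ! l))"
    by (rule sum.group[OF _ S]) (use mem in blast)+
  finally have "(\<Sum>l<length ?sel. c' l *\<^sub>R a (?sel ! l)) = (\<Sum>\<eta>\<in>S. b' \<eta> *\<^sub>R a \<eta>)" ..
  moreover have "b' \<eta> = 0" if "\<eta> \<notin> set ?sel" for \<eta>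
    unfolding b'_def using that nth_mem[of _ ?sel] by (intro sum.neutral) blast
  ultimately show ?case using sub by (intro conjI exI[of _ b']) auto
qed

text \<open>At residual 0, independence gives \<open>c = b\<close> on \<open>S\<close>;
  \<open>c\<close> has no zero there and \<open>b\<close> vanishes off the selection, so no element
  of \<open>S\<close> is missing.\<close>

lemma exact_recovery:
  assumes S: "finite S"
  shows "exact_recovery a S"
  unfolding exact_recovery_def reachable_support_def
proof (intro allI impI)
  fix c T
  assume c: "\<forall>\<theta>\<in>S. c \<theta> \<noteq> 0"
    and "\<exists>sel. omp_run a (\<Sum>\<theta>\<in>S. c \<theta> *\<^sub>R a \<theta>) sel 0 \<and> T = set sel"
  then obtain sel where run: "omp_run a (\<Sum>\<theta>\<in>S. c \<theta> *\<^sub>R a \<theta>) sel 0" and T: "T = set sel"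
    by blast
  from omp_run_support[OF S run] obtain b where sub: "set sel \<subseteq> S"
    and b: "0 = (\<Sum>\<theta>\<in>S. c \<theta> *\<^sub>R a \<theta>) - (\<Sum>\<theta>\<in>S. b \<theta> *\<^sub>R a \<theta>)" "\<forall>\<theta>\<in>S - set sel. b \<theta> = 0"
    by blast
  have "(\<Sum>\<theta>\<in>S. (c \<theta> - b \<theta>) *\<^sub>R a \<theta>) = 0"
    using b(1) by (simp add: scaleR_diff_left sum_subtractf)
  from independent[OF S this] have "c \<theta> = b \<theta>" if "\<theta> \<in> S" for \<theta> using that by simp
  then show "T = S" using T sub b(2) c by fastforce
qed

end

section \<open>Verification of the dictionary properties\<close>

theorem theorem3:
  fixes a :: "real \<Rightarrow> 'h::{real_inner, complete_space}"
    and \<phi> :: "real \<Rightarrow> real" and p :: real and Sstar :: "real set"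
  assumes "cmf \<phi>" and "\<phi> 0 = 1" and "(\<phi> \<longlongrightarrow> 0) at_top"
    and "0 < p" and "p \<le> 1"
    and "\<forall>\<theta> \<theta>'. inner (a \<theta>) (a \<theta>') = \<phi> (\<bar>\<theta> - \<theta>'\<bar> powr p)"
    and "finite Sstar"
  shows "exact_recovery a Sstar"
proof -
  define \<psi> where "\<psi> = (\<lambda>t. \<phi> (t powr p))"
  \<comment> \<open>This is the case \<open>k = 0\<close>, \<open>b = 0\<close>, up to the factor
    \<open>t powr 0\<close>, which is 1 for positive \<open>t\<close> but 0 at
    \<open>t = 0\<close>.\<close>
  have cm: "cm_upto n \<psi>" for n
    by (rule cm_upto_cong[OF cmf_cm_upto_powr[OF assms(1,4,5) order_refl, of n 0]])
      (simp add: \<psi>_def)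
  have \<psi>0: "\<psi> 0 = 1" by (simp add: \<psi>_def assms(2))
  have "(\<phi> \<longlongrightarrow> \<phi> 0) (at_right 0)" using assms(1) by (simp add: cmf_def)
  moreover have "filterlim (\<lambda>t. t powr p) (at_right 0) (at_right 0)" using assms(4) by real_asymp
  ultimately have "(\<psi> \<longlongrightarrow> \<phi> 0) (at_right 0)"
    unfolding \<psi>_def by (rule filterlim_compose)
  then have lim0: "(\<psi> \<longlongrightarrow> \<psi> 0) (at_right 0)" by (simp add: \<psi>0 assms(2))
  have nonneg: "0 \<le> \<psi> t" if "0 \<le> t" for t
    using that cm_upto_nonneg[OF cm, of t] \<psi>0 by (cases "t = 0") auto
  interpret cm_dictionary a \<psi>
  proof
    show "inner (a x) (a y) = \<psi> \<bar>x - y\<bar>" for x y by (simp add: assms(6) \<psi>_def)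
    show "(\<psi> \<longlongrightarrow> 1) (at_right 0)" using lim0 \<psi>0 by simp
    have "filterlim (\<lambda>t. t powr p) at_top at_top" using assms(4) by real_asymp
    then show "(\<psi> \<longlongrightarrow> 0) at_top"
      unfolding \<psi>_def by (rule filterlim_compose[OF assms(3)])
  next
    fix d t :: real assume "0 \<le> d" "d \<le> t"
    \<comment> \<open>Midpoint convexity is the second difference at \<open>t - d\<close> with step
      \<open>d\<close>.\<close>
    then show "2 * \<psi> t \<le> \<psi> (t - d) + \<psi> (t + d)"
      using cm_bdiff_nonneg[OF cm lim0, of "t - d" d "Suc (Suc 0)" 0] by (simp add: algebra_simps)
  next
    fix S :: "real set" and C z :: real and \<beta>
    assume S: "finite S" "0 \<le> C"
      and le: "\<And>\<theta>. \<theta> \<in> S \<Longrightarrow> 0 < \<beta> \<theta> \<Longrightarrow> inner (\<Sum>\<eta>\<in>S. \<beta> \<eta> *\<^sub>R a \<eta>) (a \<theta>) \<le> C"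
    have eq: "inner (\<Sum>\<eta>\<in>S. \<beta> \<eta> *\<^sub>R a \<eta>) (a z) = (\<Sum>\<eta>\<in>S. \<beta> \<eta> * \<psi> \<bar>z - \<eta>\<bar>)" for z
      by (simp add: inner_sum_left assms(6) \<psi>_def abs_minus_commute)
    show "inner (\<Sum>\<eta>\<in>S. \<beta> \<eta> *\<^sub>R a \<eta>) (a z) \<le> C"
      unfolding eq
    proof (rule cm_kernel_max[OF cm_continuous_on[OF cm lim0] _ _ S])
      show "0 \<le> bdiff j (\<lambda>k. \<psi> (real k * h)) k" if "0 < h" for h j k
        using cm_bdiff_nonneg[OF cm lim0, of 0 h j k] that by simp
      show "(\<Sum>\<eta>\<in>S. \<beta> \<eta> * \<psi> \<bar>\<theta> - \<eta>\<bar>) \<le> C" if "\<theta> \<in> S" "0 < \<beta> \<theta>" for \<theta>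
        using le[OF that] unfolding eq .
    qed (simp add: \<psi>0)
  qed (use \<psi>0 nonneg in auto)
  show ?thesis by (rule exact_recovery[OF assms(7)])
qed

end
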